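(* Let $G$ be a $\sigma$-compact, locally compact group. The following are equivalent. (1) $G$ embeds coarsely into a Hilbert space. (2) There exists a sequence of Schur multipliers $\varphi_n\colon G\times G\to\mathbb{C}$ such that (i) $\|\varphi_n\|_S\leq 1$ for every natural number $n$; (ii) each $\varphi_n$ tends to zero off tubes; (iii) $\varphi_n\to 1$ uniformly on tubes. If any of these conditions holds, one can moreover arrange that the coarse embedding in (1) is continuous and that each $\varphi_n$ in (2) is continuous.
   Context: Let $G$ be a $\sigma$-compact, locally compact group. Tubes: for a compact subset $K\subseteq G$ put $\mathrm{Tube}(K)=\{(x,y)\in G\times G\mid x^{-1}y\in K\}$. A tube in $G\times G$ is a subset of $G\times G$ contained in $\mathrm{Tube}(K)$ for some compact $K\subseteq G$. Coarse embedding: a map $u$ from $G$ into a Hilbert space $H$ (not required to be injective or continuous) is a coarse embedding if (a) for every compact $K\subseteq G$ there exists $R>0$ such that $(s,t)\in\mathrm{Tube}(K)\implies\|u(s)-u(t)\|\leq R$; and (b) for every $R>0$ there exists a compact $K\subseteq G$ such that $\|u(s)-u(t)\|\leq R\implies(s,t)\in\mathrm{Tube}(K)$. $G$ embeds coarsely into a Hilbert space if there exist a Hilbert space $H$ and a coarse embedding $u\colon G\to H$. Schur multipliers: a kernel (i.e. function) $\varphi\colon G\times G\to\mathbb{C}$, not required to be continuous, is a Schur multiplier if for every bounded operator $A=(a_{x,y})_{x,y\in G}\in B(\ell^2(G))$ (where $\ell^2(G)$ is the Hilbert space with orthonormal basis indexed by the set $G$), the matrix $(\varphi(x,y)a_{x,y})_{x,y\in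 G}$ again defines a bounded operator $M_\varphi A$ on $\ell^2(G)$. Then $M_\varphi\colon B(\ell^2(G))\to B(\ell^2(G))$ is bounded, and the Schur norm $\|\varphi\|_S$ is its operator norm. A kernel $\varphi\colon G\times G\to\mathbb{C}$ tends to zero off tubes if for every $\varepsilon>0$ there is a tube $T\subseteq G\times G$ such that $|\varphi(x,y)|<\varepsilon$ whenever $(x,y)\notin T$. "Uniformly on tubes" means uniformly on each tube. *)

theory Defs
  imports "HOL-Analysis.Analysis"
begin

section \<open>The complex Hilbert space $\ell^2(I)$ over an arbitrary index type\<close>

typedef 'i ell2 = "{f :: 'i \<Rightarrow> complex. (\<lambda>i. (cmod (f i))\<^sup>2) summable_on UNIV}"
  morphisms ell2_nth Abs_ell2
  by (rule exI[of _ "\<lambda>_. 0"]) simp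

setup_lifting type_definition_ell2

lemma ell2_summable: "(\<lambda>i. (cmod (ell2_nth f i))\<^sup>2) summable_on UNIV"
  using ell2_nth[of f] by simp

lemma ell2_eqI: "(\<And>i. ell2_nth f i = ell2_nth g i) \<Longrightarrow> f = g"
  by (metis ell2_nth_inject ext)

lemma square_summable_add:
  fixes f g :: "'i \<Rightarrow> complex"
  assumes "(\<lambda>i. (cmod (f i))\<^sup>2) summable_on UNIV" "(\<lambda>i. (cmod (g i))\<^sup>2) summable_on UNIV"
  shows "(\<lambda>i. (cmod (f i + g i))\<^sup>2) summable_on UNIV"
proof (rule summable_on_comparison_test)
  show "(\<lambda>i. 2 * (cmod (f i))\<^sup>2 + 2 * (cmod (g i))\<^sup>2) summable_on UNIV"
    by (intro summable_on_add summable_on_cmult_right assms)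
  fix i
  have "(cmod (f i + g i))\<^sup>2 \<le> (cmod (f i) + cmod (g i))\<^sup>2"
    by (intro power_mono norm_triangle_ineq) auto
  also have "\<dots> \<le> 2 * (cmod (f i))\<^sup>2 + 2 * (cmod (g i))\<^sup>2"
    using sum_squares_bound[of "cmod (f i)" "cmod (g i)"] by (simp add: power2_sum)
  finally show "(cmod (f i + g i))\<^sup>2 \<le> 2 * (cmod (f i))\<^sup>2 + 2 * (cmod (g i))\<^sup>2" .
qed simp

lemma square_summable_scale:
  fixes f :: "'i \<Rightarrow> complex"
  assumes "(\<lambda>i. (cmod (f i))\<^sup>2) summable_on UNIV"
  shows "(\<lambda>i. (cmod (c * f i))\<^sup>2) summable_on UNIV"
  using summable_on_cmult_right[OF assms, of "(cmod c)\<^sup>2"]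
  by (simp add: norm_mult power_mult_distrib)

lemma square_summable_inner:
  fixes f g :: "'i \<Rightarrow> complex"
  assumes "(\<lambda>i. (cmod (f i))\<^sup>2) summable_on UNIV" "(\<lambda>i. (cmod (g i))\<^sup>2) summable_on UNIV"
  shows "(\<lambda>i. inner (f i) (g i)) summable_on UNIV"
proof (rule abs_summable_summable, rule summable_on_comparison_test)
  show "(\<lambda>i. (cmod (f i))\<^sup>2 + (cmod (g i))\<^sup>2) summable_on UNIV"
    by (intro summable_on_add assms)
  fix i
  have "norm (inner (f i) (g i)) \<le> cmod (f i) * cmod (g i)"
    using Cauchy_Schwarz_ineq2 by simp
  also have "\<dots> \<le> (cmod (f i))\<^sup>2 + (cmod (g i))\<^sup>2"
    using sum_squares_bound[of "cmod (f i)" "cmod (g i)"]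
      mult_nonneg_nonneg[OF norm_ge_zero[of "f i"] norm_ge_zero[of "g i"]] by linarith
  finally show "norm (inner (f i) (g i)) \<le> (cmod (f i))\<^sup>2 + (cmod (g i))\<^sup>2" .
qed simp

lift_definition ell2_scale :: "complex \<Rightarrow> 'i ell2 \<Rightarrow> 'i ell2"
  is "\<lambda>c f i. c * f i"
  by (simp add: square_summable_scale)

lift_definition ell2_basis :: "'i \<Rightarrow> 'i ell2"
  is "\<lambda>j i. if i = j then 1 else 0"
proof -
  fix j :: 'i
  show "(\<lambda>i. (cmod (if i = j then 1 else 0))\<^sup>2) summable_on UNIV"
    by (rule finite_nonzero_values_imp_summable_on) (rule finite_subset[of _ "{j}"]; auto)
qed

instantiation ell2 :: (type) real_vector
begin

lift_definition zero_ell2 :: "'a ell2" is "\<lambda>_. 0"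
  by simp

lift_definition plus_ell2 :: "'a ell2 \<Rightarrow> 'a ell2 \<Rightarrow> 'a ell2" is "\<lambda>f g i. f i + g i"
  by (simp add: square_summable_add)

lift_definition uminus_ell2 :: "'a ell2 \<Rightarrow> 'a ell2" is "\<lambda>f i. - f i"
  by simp

lift_definition minus_ell2 :: "'a ell2 \<Rightarrow> 'a ell2 \<Rightarrow> 'a ell2" is "\<lambda>f g i. f i - g i"
proof -
  fix f g :: "'a \<Rightarrow> complex"
  assume "(\<lambda>i. (cmod (f i))\<^sup>2) summable_on UNIV" "(\<lambda>i. (cmod (g i))\<^sup>2) summable_on UNIV"
  then show "(\<lambda>i. (cmod (f i - g i))\<^sup>2) summable_on UNIV"
    using square_summable_add[of f "\<lambda>i. - g i"] by simp
qed

lift_definition scaleR_ell2 :: "real \<Rightarrow> 'a ell2 \<Rightarrow> 'a ell2" is "\<lambda>r f i. r *\<^sub>R f i"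
  by (simp add: scaleR_conv_of_real square_summable_scale del: norm_scaleR)

instance
proof
  fix f g h :: "'a ell2" and r s :: real
  note [simp] = zero_ell2.rep_eq plus_ell2.rep_eq uminus_ell2.rep_eq minus_ell2.rep_eq
    scaleR_ell2.rep_eq
  show "f + g + h = f + (g + h)" "f + g = g + f" "0 + f = f" "- f + f = 0" "f - g = f + - g"
    "r *\<^sub>R (f + g) = r *\<^sub>R f + r *\<^sub>R g" "(r + s) *\<^sub>R f = r *\<^sub>R f + s *\<^sub>R f"
    "r *\<^sub>R s *\<^sub>R f = (r * s) *\<^sub>R f" "1 *\<^sub>R f = f"
    by (rule ell2_eqI; simp add: algebra_simps)+
qed

end

(* The inner product below is the real part of the complex one, so the norm is the usual
   Hilbert-space norm. *)
instantiation ell2 :: (type) real_inner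
begin

definition inner_ell2 :: "'a ell2 \<Rightarrow> 'a ell2 \<Rightarrow> real"
  where "inner_ell2 f g = (\<Sum>\<^sub>\<infinity>i. inner (ell2_nth f i) (ell2_nth g i))"

definition norm_ell2 :: "'a ell2 \<Rightarrow> real"
  where "norm_ell2 f = sqrt (inner f f)"

definition sgn_ell2 :: "'a ell2 \<Rightarrow> 'a ell2"
  where "sgn_ell2 f = f /\<^sub>R norm f"

definition dist_ell2 :: "'a ell2 \<Rightarrow> 'a ell2 \<Rightarrow> real"
  where "dist_ell2 f g = norm (f - g)"

definition uniformity_ell2 :: "('a ell2 \<times> 'a ell2) filter"
  where "uniformity_ell2 = (INF e\<in>{0<..}. principal {(x, y). dist x y < e})"

definition open_ell2 :: "'a ell2 set \<Rightarrow> bool"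
  where "open_ell2 U \<longleftrightarrow> (\<forall>x\<in>U. \<forall>\<^sub>F (x', y) in uniformity. x' = x \<longrightarrow> y \<in> U)"

instance
proof
  fix f g h :: "'a ell2" and r s :: real
  note [simp] = zero_ell2.rep_eq plus_ell2.rep_eq uminus_ell2.rep_eq minus_ell2.rep_eq
    scaleR_ell2.rep_eq
  note sm = square_summable_inner[OF ell2_summable ell2_summable]
  show "dist f g = norm (f - g)" by (rule dist_ell2_def)
  show "sgn f = f /\<^sub>R norm f" by (rule sgn_ell2_def)
  show "uniformity = (INF e\<in>{0<..}. principal {(x, y :: 'a ell2). dist x y < e})"
    by (rule uniformity_ell2_def)
  show "open U \<longleftrightarrow> (\<forall>x\<in>U. \<forall>\<^sub>F (x', y) in uniformity. x' = x \<longrightarrow> y \<in> U)"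
    for U :: "'a ell2 set" by (rule open_ell2_def)
  show "inner f g = inner g f"
    unfolding inner_ell2_def by (rule infsum_cong) (rule inner_commute)
  show "inner (f + g) h = inner f h + inner g h"
    unfolding inner_ell2_def by (simp add: inner_add_left infsum_add sm)
  show "inner (r *\<^sub>R f) g = r * inner f g"
    unfolding inner_ell2_def by (simp add: infsum_cmult_right')
  show "0 \<le> inner f f"
    unfolding inner_ell2_def by (rule infsum_nonneg) simp
  show "inner f f = 0 \<longleftrightarrow> f = 0"
  proof
    assume "inner f f = 0"
    then have "(\<Sum>\<^sub>\<infinity>i. inner (ell2_nth f i) (ell2_nth f i)) \<le> 0"
      by (simp add: inner_ell2_def)
    then have "inner (ell2_nth f i) (ell2_nth f i) = 0" for i
      by (rule nonneg_infsum_le_0D[OF _ sm]) auto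
    then show "f = 0"
      by (intro ell2_eqI) simp
  qed (simp add: inner_ell2_def)
  show "norm f = sqrt (inner f f)" by (rule norm_ell2_def)
qed

end

lemma norm_ell2_square: "(norm f)\<^sup>2 = (\<Sum>\<^sub>\<infinity>i. (cmod (ell2_nth f i))\<^sup>2)"
  by (simp only: power2_norm_eq_inner inner_ell2_def)

lemma finite_sum_le_norm_ell2:
  "finite F \<Longrightarrow> (\<Sum>i\<in>F. (cmod (ell2_nth f i))\<^sup>2) \<le> (norm f)\<^sup>2"
  unfolding norm_ell2_square by (rule finite_sum_le_infsum[OF ell2_summable]) auto

lemma cmod_le_norm_ell2: "cmod (ell2_nth f i) \<le> norm f"
  using finite_sum_le_norm_ell2[of "{i}" f] by (simp add: power2_le_iff_abs_le)

instance ell2 :: (type) complete_space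
proof
  fix X :: "nat \<Rightarrow> 'a ell2"
  assume X: "Cauchy X"
  have minus: "ell2_nth (f - g) i = ell2_nth f i - ell2_nth g i" for f g :: "'a ell2" and i
    by (rule minus_ell2.rep_eq[THEN fun_cong])
  have "Cauchy (\<lambda>n. ell2_nth (X n) i)" for i
    using X unfolding Cauchy_def dist_norm
    by (metis (no_types) cmod_le_norm_ell2 minus order_le_less_trans)
  then have "\<forall>i. \<exists>l. (\<lambda>n. ell2_nth (X n) i) \<longlonglongrightarrow> l"
    by (simp add: Cauchy_convergent_iff convergent_def)
  then obtain L where L: "\<And>i. (\<lambda>n. ell2_nth (X n) i) \<longlonglongrightarrow> L i"
    unfolding choice_iff by blast
  have bound: "\<exists>N. \<forall>n\<ge>N. \<forall>F. finite F \<longrightarrow> (\<Sum>i\<in>F. (cmod (ell2_nth (X n) i - L i))\<^sup>2) \<le> e\<^sup>2"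
    if e: "e > 0" for e :: real
  proof -
    obtain N where N: "\<And>m n. m \<ge> N \<Longrightarrow> n \<ge> N \<Longrightarrow> norm (X m - X n) < e"
      using X e unfolding Cauchy_def dist_norm by blast
    have "(\<Sum>i\<in>F. (cmod (ell2_nth (X n) i - L i))\<^sup>2) \<le> e\<^sup>2" if "n \<ge> N" "finite F" for n F
    proof (rule LIMSEQ_le_const2)
      show "(\<lambda>m. \<Sum>i\<in>F. (cmod (ell2_nth (X n) i - ell2_nth (X m) i))\<^sup>2)
        \<longlonglongrightarrow> (\<Sum>i\<in>F. (cmod (ell2_nth (X n) i - L i))\<^sup>2)"
        by (intro tendsto_intros L)
      have "(\<Sum>i\<in>F. (cmod (ell2_nth (X n) i - ell2_nth (X m) i))\<^sup>2) \<le> e\<^sup>2" if "m \<ge> N" for m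
        using finite_sum_le_norm_ell2[OF \<open>finite F\<close>, of "X n - X m"]
          power_mono[OF less_imp_le[OF N[OF \<open>n \<ge> N\<close> that]] norm_ge_zero, of 2]
        by (simp add: minus)
      then show "\<exists>M. \<forall>m\<ge>M. (\<Sum>i\<in>F. (cmod (ell2_nth (X n) i - ell2_nth (X m) i))\<^sup>2) \<le> e\<^sup>2"
        by blast
    qed
    then show ?thesis by blast
  qed
  have diff: "(\<lambda>i. (cmod (ell2_nth (X n) i - L i))\<^sup>2) summable_on UNIV"
    if "\<forall>F. finite F \<longrightarrow> (\<Sum>i\<in>F. (cmod (ell2_nth (X n) i - L i))\<^sup>2) \<le> b" for n b
    by (rule nonneg_bdd_above_summable_on) (use that in \<open>auto intro!: bdd_aboveI2[where M = b]\<close>)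
  obtain n0 where "\<forall>F. finite F \<longrightarrow> (\<Sum>i\<in>F. (cmod (ell2_nth (X n0) i - L i))\<^sup>2) \<le> 1\<^sup>2"
    using bound[of 1] by auto
  from square_summable_add[OF ell2_summable[of "X n0"],
      of "\<lambda>i. - (ell2_nth (X n0) i - L i)"] diff[OF this]
  have "(\<lambda>i. (cmod (L i))\<^sup>2) summable_on UNIV"
    by (simp add: norm_minus_commute)
  then have nthL: "ell2_nth (Abs_ell2 L) = L"
    by (simp add: Abs_ell2_inverse)
  have "X \<longlonglongrightarrow> Abs_ell2 L"
  proof (rule metric_LIMSEQ_I)
    fix e :: real
    assume "e > 0"
    then obtain N where N: "\<And>n F. n \<ge> N \<Longrightarrow> finite F \<Longrightarrow>
        (\<Sum>i\<in>F. (cmod (ell2_nth (X n) i - L i))\<^sup>2) \<le> (e/2)\<^sup>2"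
      using bound[of "e/2"] by auto
    have "dist (X n) (Abs_ell2 L) < e" if "n \<ge> N" for n
    proof -
      have "(norm (X n - Abs_ell2 L))\<^sup>2 \<le> (e/2)\<^sup>2"
        unfolding norm_ell2_square minus nthL
        using N[OF that] diff[of n "(e/2)\<^sup>2"] by (intro infsum_le_finite_sums) auto
      then have "norm (X n - Abs_ell2 L) \<le> e/2"
        by (rule power2_le_imp_le) (use \<open>e > 0\<close> in simp)
      then show ?thesis
        using \<open>e > 0\<close> by (simp add: dist_norm)
    qed
    then show "\<exists>N. \<forall>n\<ge>N. dist (X n) (Abs_ell2 L) < e" by blast
  qed
  then show "convergent X"
    by (rule convergentI)
qed


section \<open>Schur multipliers\<close>

(* The bounded complex-linear operators on ell2; onorm is the operator norm on them. *)
definition bounded_op :: "('i ell2 \<Rightarrow> 'i ell2) \<Rightarrow> bool"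
  where "bounded_op A \<longleftrightarrow>
    bounded_linear A \<and> (\<forall>c f. A (ell2_scale c f) = ell2_scale c (A f))"

definition matrix_entry :: "('i ell2 \<Rightarrow> 'i ell2) \<Rightarrow> 'i \<Rightarrow> 'i \<Rightarrow> complex"
  where "matrix_entry A x y = ell2_nth (A (ell2_basis y)) x"

definition schur_product_op ::
  "('i \<times> 'i \<Rightarrow> complex) \<Rightarrow> ('i ell2 \<Rightarrow> 'i ell2) \<Rightarrow> ('i ell2 \<Rightarrow> 'i ell2) \<Rightarrow> bool"
  where "schur_product_op \<phi> A B \<longleftrightarrow>
    bounded_op B \<and> (\<forall>x y. matrix_entry B x y = \<phi> (x, y) * matrix_entry A x y)"

definition schur_multiplier :: "('i \<times> 'i \<Rightarrow> complex) \<Rightarrow> bool"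
  where "schur_multiplier \<phi> \<longleftrightarrow> (\<forall>A. bounded_op A \<longrightarrow> (\<exists>B. schur_product_op \<phi> A B))"

(* A bounded operator is determined by its matrix, so for a Schur multiplier the description
   below picks out the only operator with the required matrix. *)
definition schur_map :: "('i \<times> 'i \<Rightarrow> complex) \<Rightarrow> ('i ell2 \<Rightarrow> 'i ell2) \<Rightarrow> ('i ell2 \<Rightarrow> 'i ell2)"
  where "schur_map \<phi> A = (THE B. schur_product_op \<phi> A B)"

(* The operator norm of schur_map \<phi> on the bounded operators. It is taken in [0, \<infinity>], because a
   supremum of reals would have an unspecified value on an unbounded set; for a Schur multiplier
   it is finite. *)
definition schur_norm :: "('i \<times> 'i \<Rightarrow> complex) \<Rightarrow> ennreal"
  where "schur_norm \<phi> = (SUP A\<in>{A. bounded_op A \<and> onorm A \<le> 1}. ennreal (onorm (schur_map \<phi> A)))"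


section \<open>Tubes and coarse embeddings\<close>

(* Topological groups are written additively, as in the class topological_group_add. The group
   operation is not assumed to be commutative; - x + y stands for the product of the inverse of x
   with y, in this order. *)

definition sigma_compact :: "'a::topological_space set \<Rightarrow> bool"
  where "sigma_compact S \<longleftrightarrow> (\<exists>C :: nat \<Rightarrow> 'a set. (\<forall>n. compact (C n)) \<and> S = (\<Union>n. C n))"

definition Tube :: "'a::topological_group_add set \<Rightarrow> ('a \<times> 'a) set"
  where "Tube K = {(x, y). - x + y \<in> K}"

definition is_tube :: "('a::topological_group_add \<times> 'a) set \<Rightarrow> bool"
  where "is_tube T \<longleftrightarrow> (\<exists>K. compact K \<and> T \<subseteq> Tube K)"

(* The class {real_inner, complete_space} is that of real Hilbert spaces. It also covers complex
   Hilbert spaces, with the real part of the inner product: only the norm is used. *)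
definition coarse_embedding ::
  "('a::topological_group_add \<Rightarrow> 'h::{real_inner, complete_space}) \<Rightarrow> bool"
  where "coarse_embedding u \<longleftrightarrow>
    (\<forall>K. compact K \<longrightarrow> (\<exists>R>0. \<forall>s t. (s, t) \<in> Tube K \<longrightarrow> norm (u s - u t) \<le> R)) \<and>
    (\<forall>R>0. \<exists>K. compact K \<and> (\<forall>s t. norm (u s - u t) \<le> R \<longrightarrow> (s, t) \<in> Tube K))"

(* HOL has no quantifier over types, so the existential over the Hilbert space is realised in
   one space of sufficiently large dimension: every Hilbert space is isometric to some ell2, and
   the closed span of the range of a map on 'a embeds isometrically into ('a \<times> nat) ell2. *)
definition embeds_coarsely :: "'a::topological_group_add itself \<Rightarrow> bool"
  where "embeds_coarsely _ \<longleftrightarrow> (\<exists>u :: 'a \<Rightarrow> ('a \<times> nat) ell2. coarse_embedding u)"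

definition tends_to_zero_off_tubes :: "('a::topological_group_add \<times> 'a \<Rightarrow> complex) \<Rightarrow> bool"
  where "tends_to_zero_off_tubes \<phi> \<longleftrightarrow>
    (\<forall>\<epsilon>>0. \<exists>T. is_tube T \<and> (\<forall>x y. (x, y) \<notin> T \<longrightarrow> cmod (\<phi> (x, y)) < \<epsilon>))"

definition schur_approximation :: "(nat \<Rightarrow> 'a::topological_group_add \<times> 'a \<Rightarrow> complex) \<Rightarrow> bool"
  where "schur_approximation \<phi> \<longleftrightarrow>
    (\<forall>n. schur_multiplier (\<phi> n)) \<and>
    (\<forall>n. schur_norm (\<phi> n) \<le> 1) \<and>
    (\<forall>n. tends_to_zero_off_tubes (\<phi> n)) \<and>
    (\<forall>T. is_tube T \<longrightarrow> uniform_limit T \<phi> (\<lambda>_. 1) sequentially)"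

end

theory Submission
  imports Defs
begin

text \<open>Write \<open>G\<close> for the group. Both conditions are translated into statements about real positive
definite kernels on sets, and such kernels are the same thing as Gram matrices of vectors in some
\<open>\<ell>\<^sup>2\<close>: by \<open>kolmogorov_decomposition\<close>, every positive definite kernel on \<open>I\<close> is realised in
\<open>\<ell>\<^sup>2\<close> of any set into which \<open>I\<close> embeds. In particular only the distances \<open>norm (u x - u y)\<close> of a coarse
embedding matter, and its values may be taken in \<open>\<ell>\<^sup>2(G \<times> \<nat>)\<close>.

From a coarse embedding \<open>u\<close> one obtains the Gaussian kernels
\<open>exp (- (norm (u x - u y))\<^sup>2 / (n + 1))\<close>. They are positive definite by Schoenberg's argument (expand
the exponential and use that the pointwise product of positive definite kernels is positive definite),
and a positive definite kernel with diagonal at most \<open>1\<close> is a Schur multiplier of norm at most \<open>1\<close>: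
writing it as \<open>\<Sum>i. r x i * r y i\<close>, the multiplier is \<open>A \<mapsto> \<Sum>i. D i A D i\<close> with the diagonal
operators \<open>D i\<close> of entries \<open>r x i\<close>, whose squares sum up to at most the identity. The two properties of a
coarse embedding say exactly that these kernels tend to \<open>1\<close> uniformly on tubes and to \<open>0\<close> off tubes.

Conversely, a Schur multiplier \<open>\<phi>\<close> of norm at most \<open>1\<close> has the form
\<open>Re (\<phi> (x, y)) = inner (\<xi> x) (\<eta> y)\<close> with unit vectors (\<open>schur_contraction_factorisation\<close>, a version of a
theorem of Grothendieck). This asks for a positive definite kernel on two copies of \<open>G\<close> with
prescribed values on the diagonal and on the off-diagonal block. By duality such a completion exists
iff \<open>\<Sum>x y. Q x y * g x y \<ge> 0\<close> for the prescribed values \<open>g\<close> and all finitely supported positive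
definite \<open>Q\<close> that vanish where nothing is prescribed (\<open>pos_def_completion\<close>); rescaling such a \<open>Q\<close> by its
diagonal turns its off-diagonal block into a contraction, and the norm bound on \<open>\<phi>\<close> gives the
inequality. Where \<open>\<phi>\<close> is close to \<open>1\<close> the vectors \<open>\<xi> x\<close> and \<open>\<eta> y\<close> are close to each other, in
particular \<open>\<xi> x\<close> and \<open>\<eta> x\<close> are; where \<open>\<phi>\<close> is small, \<open>\<xi> x\<close> and \<open>\<eta> y\<close>, hence also \<open>\<eta> x\<close> and \<open>\<eta> y\<close>,
are far apart. If the \<open>\<phi> n\<close> are chosen to approach \<open>1\<close> fast enough along a compact exhaustion, the
squared distances of the corresponding maps \<open>\<eta>\<close> have a convergent sum, which is the squared distance function of a coarse embedding
(\<open>coarse_embedding_of_maps\<close>).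

For continuity, a coarse embedding is averaged against a continuous partition of unity subordinate to
countably many translates of a compact neighbourhood of the unit
(\<open>continuous_coarse_embedding\<close>). This moves every value by a bounded amount, and the
Gaussian kernels of a continuous map are continuous.\<close>

section \<open>Completion of partially defined positive definite kernels\<close>

definition pos_def_on :: "'i set \<Rightarrow> ('i \<Rightarrow> 'i \<Rightarrow> real) \<Rightarrow> bool"
  where "pos_def_on F k \<longleftrightarrow> (\<forall>c. 0 \<le> (\<Sum>x\<in>F. \<Sum>y\<in>F. c x * c y * k x y))"

definition pos_def_kernel :: "('i \<Rightarrow> 'i \<Rightarrow> real) \<Rightarrow> bool"
  where "pos_def_kernel k \<longleftrightarrow> (\<forall>x y. k x y = k y x) \<and> (\<forall>F. finite F \<longrightarrow> pos_def_on F k)"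

lemma sum_square_restrict:
  fixes h :: "'i \<Rightarrow> 'i \<Rightarrow> real"
  assumes "finite F" "F' \<subseteq> F" "\<And>x y. x \<notin> F' \<or> y \<notin> F' \<Longrightarrow> h x y = 0"
  shows "(\<Sum>x\<in>F. \<Sum>y\<in>F. h x y) = (\<Sum>x\<in>F'. \<Sum>y\<in>F'. h x y)"
proof -
  have "(\<Sum>x\<in>F. \<Sum>y\<in>F. h x y) = (\<Sum>x\<in>F'. \<Sum>y\<in>F. h x y)"
    using assms by (intro sum.mono_neutral_right) auto
  also have "\<dots> = (\<Sum>x\<in>F'. \<Sum>y\<in>F'. h x y)"
    using assms by (intro sum.cong[OF refl] sum.mono_neutral_right) auto
  finally show ?thesis .
qed

lemma pos_def_on_subset:
  assumes "finite F" "F' \<subseteq> F" "pos_def_on F k"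
  shows "pos_def_on F' k"
  unfolding pos_def_on_def
proof
  fix c
  define d where "d = (\<lambda>x. if x \<in> F' then c x else (0::real))"
  have "0 \<le> (\<Sum>x\<in>F. \<Sum>y\<in>F. d x * d y * k x y)"
    using assms(3) by (simp add: pos_def_on_def)
  also have "\<dots> = (\<Sum>x\<in>F'. \<Sum>y\<in>F'. d x * d y * k x y)"
    by (rule sum_square_restrict[OF assms(1,2)]) (auto simp: d_def)
  also have "\<dots> = (\<Sum>x\<in>F'. \<Sum>y\<in>F'. c x * c y * k x y)"
    by (intro sum.cong refl) (simp add: d_def)
  finally show "0 \<le> (\<Sum>x\<in>F'. \<Sum>y\<in>F'. c x * c y * k x y)" .
qed

lemma pos_def_on_pair:
  assumes "finite F" "pos_def_on F k" "x \<in> F" "y \<in> F" "x \<noteq> y" "k x y = k y x"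
  shows "0 \<le> a\<^sup>2 * k x x + b\<^sup>2 * k y y + 2 * a * b * k x y"
proof -
  have "pos_def_on {x, y} k"
    using pos_def_on_subset[OF assms(1) _ assms(2)] assms(3,4) by auto
  then have "0 \<le> (\<Sum>u\<in>{x, y}. \<Sum>v\<in>{x, y}. ((\<lambda>_. 0)(x := a, y := b)) u * ((\<lambda>_. 0)(x := a, y := b)) v * k u v)"
    unfolding pos_def_on_def by blast
  also have "\<dots> = a\<^sup>2 * k x x + b\<^sup>2 * k y y + 2 * a * b * k x y"
    using assms(5,6) by (simp add: power2_eq_square algebra_simps)
  finally show ?thesis .
qed

lemma pos_def_on_diag:
  assumes "finite F" "pos_def_on F k" "x \<in> F"
  shows "0 \<le> k x x"
proof -
  have "pos_def_on {x} k"
    using pos_def_on_subset[OF assms(1) _ assms(2)] assms(3) by auto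
  then have "0 \<le> (\<Sum>u\<in>{x}. \<Sum>v\<in>{x}. (\<lambda>_. 1) u * (\<lambda>_. 1) v * k u v)"
    unfolding pos_def_on_def by (rule allE)
  then show ?thesis by simp
qed

lemma pos_def_on_bound:
  assumes "finite F" "pos_def_on F k" "x \<in> F" "y \<in> F" "k x y = k y x"
  shows "\<bar>k x y\<bar> \<le> (k x x + k y y) / 2"
proof (cases "x = y")
  case True
  then show ?thesis using pos_def_on_diag[OF assms(1-3)] by simp
next
  case False
  show ?thesis
    using pos_def_on_pair[OF assms(1-4) False assms(5), of 1 1]
      pos_def_on_pair[OF assms(1-4) False assms(5), of 1 "-1"] by auto
qed

text \<open>A positive semidefinite \<open>2 \<times> 2\<close> block with a zero on its diagonal is diagonal: otherwise a large
multiple of \<open>x\<close> makes the quadratic form negative.\<close>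

lemma pos_def_on_zero_row:
  assumes "finite F" "pos_def_on F k" "x \<in> F" "y \<in> F" "k x y = k y x" "k x x = 0"
  shows "k x y = 0"
proof (rule ccontr)
  assume nz: "k x y \<noteq> 0"
  then have "x \<noteq> y" using assms by auto
  from pos_def_on_pair[OF assms(1-4) this assms(5), of "- (k y y + 1) / (2 * k x y)" 1]
  show False using nz assms(6) by (simp add: field_simps)
qed

lemma continuous_on_kernel_entry: "continuous_on UNIV (\<lambda>P :: 'i \<Rightarrow> 'j \<Rightarrow> real. P x y)"
  by (rule continuous_on_product_then_coordinatewise[OF continuous_on_product_coordinates])

text \<open>Tychonoff's theorem for the topology of pointwise convergence of kernels.\<close>

lemma compact_kernel_cube:
  fixes b :: "'i \<Rightarrow> 'j \<Rightarrow> real"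
  shows "compact {P. \<forall>x y. \<bar>P x y\<bar> \<le> b x y}"
proof -
  have 1: "compact (PiE UNIV S)" if "\<And>i. compact (S i)"
    for S :: "'x \<Rightarrow> 'y::topological_space set"
    using compactin_PiE[of "\<lambda>_. euclidean" UNIV S] that
    by (simp add: euclidean_product_topology compactin_euclidean_iff)
  have "{P. \<forall>x y. \<bar>P x y\<bar> \<le> b x y} = PiE UNIV (\<lambda>x. PiE UNIV (\<lambda>y. {- b x y..b x y}))"
    by (auto simp: PiE_def Pi_def abs_le_iff minus_le_iff)
  then show ?thesis by (simp only:) (intro 1 compact_Icc)
qed

lemma closed_symmetric_kernels: "closed {P :: 'i \<Rightarrow> 'i \<Rightarrow> real. \<forall>x y. P x y = P y x}"
  by (intro closed_Collect_all closed_Collect_eq continuous_on_kernel_entry)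

lemma closed_pos_def_on: "closed {P :: 'i \<Rightarrow> 'i \<Rightarrow> real. pos_def_on F P}"
  unfolding pos_def_on_def
  by (intro closed_Collect_all closed_Collect_le continuous_intros continuous_on_kernel_entry)

text \<open>The first order condition at a minimum of a quadratic functional, in a direction in which one may move
forwards but perhaps not backwards.\<close>

lemma first_variation_nonneg:
  fixes a b :: real
  assumes "\<And>t. 0 < t \<Longrightarrow> t \<le> 1 \<Longrightarrow> 0 \<le> 2 * t * a + t\<^sup>2 * b"
  shows "0 \<le> a"
proof (rule ccontr)
  assume "\<not> 0 \<le> a"
  define t where "t = min 1 (- a / (\<bar>b\<bar> + 1))"
  have t: "0 < t" "t \<le> 1" "t \<le> - a / (\<bar>b\<bar> + 1)"
    using \<open>\<not> 0 \<le> a\<close> by (auto simp: t_def intro: divide_neg_pos)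
  from t(3) have "t * (\<bar>b\<bar> + 1) \<le> - a"
    by (subst (asm) pos_le_divide_eq) auto
  have "0 \<le> t * (2 * a + t * b)"
    using assms[OF t(1,2)] by (simp add: power2_eq_square algebra_simps)
  then have "0 \<le> 2 * a + t * b"
    using t(1) by (simp add: zero_le_mult_iff)
  moreover have "t * b \<le> t * (\<bar>b\<bar> + 1)"
    using t(1) by (intro mult_left_mono) auto
  ultimately show False using \<open>t * (\<bar>b\<bar> + 1) \<le> - a\<close> \<open>\<not> 0 \<le> a\<close> by linarith
qed

text \<open>The finite form of the duality. Among all positive semidefinite matrices \<open>P\<close> on \<open>F\<close>, one minimises the
squared distance to \<open>g\<close> along the pattern. Let \<open>Q\<close> be the difference \<open>P - g\<close> on the pattern at a
minimum \<open>P\<close>. Moving \<open>P\<close> in the direction of a rank one matrix shows that \<open>Q\<close> is positive semidefinite,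
and shrinking \<open>P\<close> shows that \<open>\<Sum> Q * P \<le> 0\<close>. Since \<open>\<Sum> Q * g \<ge> 0\<close> by duality, \<open>\<Sum> Q\<^sup>2 \<le> 0\<close>.\<close>

lemma pos_def_completion_finite:
  fixes g :: "'i \<Rightarrow> 'i \<Rightarrow> real"
  assumes F: "finite F" and E: "sym E" "\<And>x. (x, x) \<in> E" and g: "\<And>x y. g x y = g y x"
    and dual: "\<And>Q. (\<And>x y. Q x y = Q y x) \<Longrightarrow> pos_def_on F Q \<Longrightarrow>
      (\<And>x y. (x, y) \<notin> E \<inter> F \<times> F \<Longrightarrow> Q x y = 0) \<Longrightarrow> 0 \<le> (\<Sum>x\<in>F. \<Sum>y\<in>F. Q x y * g x y)"
  shows "\<exists>P. (\<forall>x y. P x y = P y x) \<and> pos_def_on F P \<and>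
      (\<forall>x y. x \<notin> F \<or> y \<notin> F \<longrightarrow> P x y = 0) \<and> (\<forall>(x, y) \<in> E \<inter> F \<times> F. P x y = g x y)"
proof -
  define S where "S = {P :: 'i \<Rightarrow> 'i \<Rightarrow> real. (\<forall>x y. P x y = P y x)} \<inter> {P. pos_def_on F P} \<inter>
      {P. \<forall>x y. x \<notin> F \<or> y \<notin> F \<longrightarrow> P x y = 0}"
  define e where "e = (\<lambda>x y. if (x, y) \<in> E then 1 else 0 :: real)"
  define f where "f = (\<lambda>P. \<Sum>x\<in>F. \<Sum>y\<in>F. e x y * (P x y - g x y)\<^sup>2)"
  define c where "c = 1 + f (\<lambda>_ _. 0) + (\<Sum>x\<in>F. \<bar>g x x\<bar>)"
  have e0: "0 \<le> e x y" for x y by (simp add: e_def)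
  have closedS: "closed S"
    unfolding S_def
  proof (intro closed_Int closed_symmetric_kernels closed_pos_def_on closed_Collect_all)
    show "closed {P :: 'i \<Rightarrow> 'i \<Rightarrow> real. x \<notin> F \<or> y \<notin> F \<longrightarrow> P x y = 0}" for x y
      by (cases "x \<notin> F \<or> y \<notin> F")
        (auto intro!: closed_Collect_eq continuous_on_kernel_entry)
  qed
  have zeroS: "(\<lambda>_ _. 0) \<in> S" by (simp add: S_def pos_def_on_def)
  have f0: "0 \<le> f P" for P
    unfolding f_def by (intro sum_nonneg mult_nonneg_nonneg e0) simp
  \<comment> \<open>The diagonal belongs to the pattern, so that the competitors that do better than \<open>0\<close> are bounded.\<close>
  have bounded: "\<bar>P x y\<bar> \<le> c" if P: "P \<in> S" "f P \<le> f (\<lambda>_ _. 0)" for P x y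
  proof (cases "x \<in> F \<and> y \<in> F")
    case True
    have diag: "P z z \<le> c" if z: "z \<in> F" for z
    proof -
      have "(P z z - g z z)\<^sup>2 = e z z * (P z z - g z z)\<^sup>2" using E(2) by (simp add: e_def)
      also have "\<dots> \<le> (\<Sum>y\<in>F. e z y * (P z y - g z y)\<^sup>2)"
        by (intro member_le_sum z F mult_nonneg_nonneg e0) simp
      also have "\<dots> \<le> f P"
        unfolding f_def by (rule member_le_sum[where f = "\<lambda>x. \<Sum>y\<in>F. e x y * (P x y - g x y)\<^sup>2"])
          (auto intro!: z F sum_nonneg mult_nonneg_nonneg e0)
      finally have "(P z z - g z z)\<^sup>2 \<le> f (\<lambda>_ _. 0)" using P(2) by linarith
      moreover have "P z z - g z z \<le> 1 + (P z z - g z z)\<^sup>2"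
        using zero_le_power2[of "P z z - g z z - 1"] zero_le_power2[of "P z z - g z z"]
        by (simp add: power2_eq_square algebra_simps) 
      moreover have "\<bar>g z z\<bar> \<le> (\<Sum>x\<in>F. \<bar>g x x\<bar>)"
        by (rule member_le_sum[where f = "\<lambda>x. \<bar>g x x\<bar>"]) (auto intro!: z F)
      ultimately show ?thesis unfolding c_def by linarith
    qed
    have "\<bar>P x y\<bar> \<le> (P x x + P y y) / 2"
      using P(1) True by (intro pos_def_on_bound[OF F]) (auto simp: S_def)
    also have "\<dots> \<le> (c + c) / 2"
      using diag True by (intro divide_right_mono add_mono) auto
    finally show ?thesis by simp
  next
    case False
    then have "P x y = 0" using P(1) by (auto simp: S_def)
    moreover have "0 \<le> c" unfolding c_def using f0 by (intro add_nonneg_nonneg sum_nonneg) auto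
    ultimately show ?thesis by simp
  qed
  have compact: "compact (S \<inter> {P. \<forall>x y. \<bar>P x y\<bar> \<le> c})"
    by (intro closed_Int_compact closedS compact_kernel_cube)
  have contf: "continuous_on A f" for A
    unfolding f_def
    by (intro continuous_intros continuous_on_subset[OF continuous_on_kernel_entry]) auto
  have "S \<inter> {P. \<forall>x y. \<bar>P x y\<bar> \<le> c} \<noteq> {}"
    using zeroS bounded[OF zeroS] by auto
  from continuous_attains_inf[OF compact this contf]
  obtain P where P: "P \<in> S" and min: "\<And>R. R \<in> S \<Longrightarrow> (\<forall>x y. \<bar>R x y\<bar> \<le> c) \<Longrightarrow> f P \<le> f R"
    by auto
  have min: "f P \<le> f R" if "R \<in> S" for R
  proof (cases "f R \<le> f (\<lambda>_ _. 0)")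
    case True then show ?thesis using min[OF that] bounded[OF that] by blast
  next
    case False then show ?thesis using min[OF zeroS] bounded[OF zeroS] by force
  qed
  \<comment> \<open>Up to a factor \<open>2\<close>, \<open>Q\<close> is the gradient of \<open>f\<close> at the minimum \<open>P\<close>.\<close>
  define Q where "Q = (\<lambda>x y. if (x, y) \<in> E \<inter> F \<times> F then P x y - g x y else 0)"
  have Qe: "Q x y = e x y * (P x y - g x y)" if "x \<in> F" "y \<in> F" for x y
    using that by (simp add: Q_def e_def)
  have variation: "0 \<le> (\<Sum>x\<in>F. \<Sum>y\<in>F. Q x y * R x y)"
    if R: "\<And>t. 0 < t \<Longrightarrow> t \<le> 1 \<Longrightarrow> (\<lambda>x y. P x y + t * R x y) \<in> S" for R
  proof (rule first_variation_nonneg)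
    fix t :: real
    assume "0 < t" "t \<le> 1"
    have "f (\<lambda>x y. P x y + t * R x y) = f P + 2 * t * (\<Sum>x\<in>F. \<Sum>y\<in>F. Q x y * R x y)
        + t\<^sup>2 * (\<Sum>x\<in>F. \<Sum>y\<in>F. e x y * (R x y)\<^sup>2)"
      unfolding f_def sum_distrib_left sum.distrib[symmetric]
      by (intro sum.cong refl) (simp add: Qe power2_eq_square algebra_simps)
    then show "0 \<le> 2 * t * (\<Sum>x\<in>F. \<Sum>y\<in>F. Q x y * R x y)
        + t\<^sup>2 * (\<Sum>x\<in>F. \<Sum>y\<in>F. e x y * (R x y)\<^sup>2)"
      using min[OF R[OF \<open>0 < t\<close> \<open>t \<le> 1\<close>]] by linarith
  qed
  have posadd: "pos_def_on F (\<lambda>x y. a * P x y + t * R x y)"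
    if "0 \<le> a" "0 \<le> t" "pos_def_on F P" "pos_def_on F R" for a t P R
    unfolding pos_def_on_def
  proof
    fix d
    have "0 \<le> a * (\<Sum>x\<in>F. \<Sum>y\<in>F. d x * d y * P x y) + t * (\<Sum>x\<in>F. \<Sum>y\<in>F. d x * d y * R x y)"
      using that by (simp add: pos_def_on_def)
    then show "0 \<le> (\<Sum>x\<in>F. \<Sum>y\<in>F. d x * d y * (a * P x y + t * R x y))"
      by (simp add: sum_distrib_left sum.distrib algebra_simps)
  qed
  have posQ: "pos_def_on F Q"
    unfolding pos_def_on_def
  proof
    fix d :: "'i \<Rightarrow> real"
    define R where "R = (\<lambda>x y. if x \<in> F \<and> y \<in> F then d x * d y else 0)"
    have "pos_def_on F R"
      unfolding pos_def_on_def
    proof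
      fix a
      have "(\<Sum>x\<in>F. \<Sum>y\<in>F. a x * a y * R x y) = (\<Sum>x\<in>F. \<Sum>y\<in>F. (a x * d x) * (a y * d y))"
        by (intro sum.cong refl) (simp add: R_def)
      also have "\<dots> = (\<Sum>x\<in>F. a x * d x)\<^sup>2"
        by (simp add: power2_eq_square sum_product)
      finally show "0 \<le> (\<Sum>x\<in>F. \<Sum>y\<in>F. a x * a y * R x y)" by simp
    qed
    then have "0 \<le> (\<Sum>x\<in>F. \<Sum>y\<in>F. Q x y * R x y)"
      using P posadd[of 1 _ P R] by (intro variation) (auto simp: S_def R_def)
    also have "\<dots> = (\<Sum>x\<in>F. \<Sum>y\<in>F. d x * d y * Q x y)"
      by (intro sum.cong refl) (simp add: R_def)
    finally show "0 \<le> (\<Sum>x\<in>F. \<Sum>y\<in>F. d x * d y * Q x y)" .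
  qed
  have "0 \<le> (\<Sum>x\<in>F. \<Sum>y\<in>F. Q x y * (- P x y))"
  proof (rule variation)
    fix t :: real assume t: "0 < t" "t \<le> 1"
    have "pos_def_on F (\<lambda>x y. (1 - t) * P x y + 0 * P x y)"
      using P t by (intro posadd) (auto simp: S_def)
    then show "(\<lambda>x y. P x y + t * - P x y) \<in> S"
      using P by (auto simp: S_def algebra_simps)
  qed
  moreover have "0 \<le> (\<Sum>x\<in>F. \<Sum>y\<in>F. Q x y * g x y)"
  proof (rule dual[OF _ posQ])
    show "Q x y = Q y x" for x y
      using P E(1) g by (auto simp: S_def Q_def sym_def)
  qed (auto simp: Q_def)
  moreover have "(\<Sum>x\<in>F. \<Sum>y\<in>F. (Q x y)\<^sup>2) =
      - (\<Sum>x\<in>F. \<Sum>y\<in>F. Q x y * (- P x y)) - (\<Sum>x\<in>F. \<Sum>y\<in>F. Q x y * g x y)"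
    unfolding sum_negf[symmetric] sum_subtractf[symmetric]
    by (intro sum.cong refl) (simp add: Q_def power2_eq_square algebra_simps)
  ultimately have "(\<Sum>x\<in>F. \<Sum>y\<in>F. (Q x y)\<^sup>2) \<le> 0" by linarith
  then have "(\<Sum>x\<in>F. \<Sum>y\<in>F. (Q x y)\<^sup>2) = 0"
    by (intro antisym sum_nonneg zero_le_power2)
  then have "\<forall>x\<in>F. (\<Sum>y\<in>F. (Q x y)\<^sup>2) = 0"
    using F by (subst (asm) sum_nonneg_eq_0_iff) (auto intro!: sum_nonneg)
  then have "\<forall>x\<in>F. \<forall>y\<in>F. Q x y = 0"
    using F by (simp add: sum_nonneg_eq_0_iff)
  then have "P x y = g x y" if "(x, y) \<in> E" "x \<in> F" "y \<in> F" for x y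
    using that by (force simp: Q_def)
  with P show ?thesis by (auto simp: S_def)
qed

text \<open>The prescribed diagonal bounds all entries of a completion, so completions on finite sets lie in a
compact cube, and the finite intersection property yields one on the whole index set.\<close>

lemma pos_def_completion:
  fixes g :: "'i \<Rightarrow> 'i \<Rightarrow> real"
  assumes E: "sym E" "\<And>x. (x, x) \<in> E" and g: "\<And>x y. g x y = g y x"
    and dual: "\<And>F Q. finite F \<Longrightarrow> (\<And>x y. Q x y = Q y x) \<Longrightarrow> pos_def_on F Q \<Longrightarrow>
      (\<And>x y. (x, y) \<notin> E \<inter> F \<times> F \<Longrightarrow> Q x y = 0) \<Longrightarrow> 0 \<le> (\<Sum>x\<in>F. \<Sum>y\<in>F. Q x y * g x y)"
  shows "\<exists>P. pos_def_kernel P \<and> (\<forall>(x, y) \<in> E. P x y = g x y)"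
proof -
  define S where "S = (\<lambda>F. {P :: 'i \<Rightarrow> 'i \<Rightarrow> real. \<forall>x y. P x y = P y x} \<inter> {P. pos_def_on F P} \<inter>
      {P. \<forall>x y. (x, y) \<in> E \<inter> F \<times> F \<longrightarrow> P x y = g x y})"
  \<comment> \<open>Absolute values keep the cube nonempty at indices outside the finite sets, where the entries are \<open>0\<close>.\<close>
  define b where "b = (\<lambda>x y. (\<bar>g x x\<bar> + \<bar>g y y\<bar>) / 2)"
  have "{P. \<forall>x y. \<bar>P x y\<bar> \<le> b x y} \<inter> (\<Inter>F\<in>{F. finite F}. S F) \<noteq> {}"
  proof (rule compact_imp_fip_image[OF compact_kernel_cube])
    fix F :: "'i set"
    have "closed {P :: 'i \<Rightarrow> 'i \<Rightarrow> real. (x, y) \<in> E \<inter> F \<times> F \<longrightarrow> P x y = g x y}" for x y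
      by (cases "(x, y) \<in> E \<inter> F \<times> F")
        (auto intro!: closed_Collect_eq continuous_on_kernel_entry)
    then show "closed (S F)"
      unfolding S_def
      by (intro closed_Int closed_symmetric_kernels closed_pos_def_on closed_Collect_all)
  next
    fix I :: "'i set set"
    assume I: "finite I" "I \<subseteq> {F. finite F}"
    then have fin: "finite (\<Union>I)" by auto
    have "\<exists>P. (\<forall>x y. P x y = P y x) \<and> pos_def_on (\<Union>I) P \<and>
        (\<forall>x y. x \<notin> \<Union>I \<or> y \<notin> \<Union>I \<longrightarrow> P x y = 0) \<and>
        (\<forall>(x, y) \<in> E \<inter> (\<Union>I) \<times> (\<Union>I). P x y = g x y)"
      by (rule pos_def_completion_finite[OF fin E g]) (rule dual[OF fin])
    then obtain P where P0: "\<forall>x y. P x y = P y x" "pos_def_on (\<Union>I) P"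
        "\<forall>x y. x \<notin> \<Union>I \<or> y \<notin> \<Union>I \<longrightarrow> P x y = 0"
        "\<forall>(x, y) \<in> E \<inter> (\<Union>I) \<times> (\<Union>I). P x y = g x y"
      by (elim exE conjE)
    have P: "pos_def_on (\<Union>I) P" "P x y = P y x"
        "x \<notin> \<Union>I \<or> y \<notin> \<Union>I \<Longrightarrow> P x y = 0"
        "(x, y) \<in> E \<Longrightarrow> x \<in> \<Union>I \<Longrightarrow> y \<in> \<Union>I \<Longrightarrow> P x y = g x y" for x y
      using P0(1-3) bspec[OF P0(4), of "(x, y)"] by (simp, metis, metis, simp)
    have "\<bar>P x y\<bar> \<le> b x y" for x y
    proof (cases "x \<in> \<Union>I \<and> y \<in> \<Union>I")
      case True
      then have "\<bar>P x y\<bar> \<le> (P x x + P y y) / 2"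
        using pos_def_on_bound[OF fin P(1), of x y] P(2)[of x y] by blast
      also have "\<dots> \<le> b x y" using P(4)[of x x] P(4)[of y y] True E(2) by (simp add: b_def)
      finally show ?thesis .
    qed (use P(3) in \<open>auto simp: b_def\<close>)
    moreover have "P \<in> S F" if "F \<in> I" for F
    proof -
      have "pos_def_on F P" using pos_def_on_subset[OF fin _ P(1)] that by blast
      moreover have "P x y = g x y" if "(x, y) \<in> E" "x \<in> F" "y \<in> F" for x y
        using P(4)[OF that(1)] that \<open>F \<in> I\<close> by blast
      ultimately show ?thesis using P(2) by (simp add: S_def)
    qed
    ultimately show "{P. \<forall>x y. \<bar>P x y\<bar> \<le> b x y} \<inter> (\<Inter>F\<in>I. S F) \<noteq> {}" by blast
  qed
  then obtain P where P: "\<And>F. finite F \<Longrightarrow> P \<in> S F" by auto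
  have "P x y = g x y" if "(x, y) \<in> E" for x y
    using P[of "{x, y}"] that by (simp add: S_def)
  moreover have "pos_def_kernel P"
    using P P[of "{}"] by (simp add: S_def pos_def_kernel_def)
  ultimately show ?thesis by auto
qed

text \<open>For a finite set \<open>X\<close> this says that the operator norm of \<open>A\<close> is at most \<open>1\<close>. The bound by half the sum
of squares is equivalent to the one by the product of norms, by homogeneity, and avoids square roots.\<close>

definition contractive_matrix :: "'i set \<Rightarrow> ('i \<Rightarrow> 'i \<Rightarrow> real) \<Rightarrow> bool"
  where "contractive_matrix X A \<longleftrightarrow>
    (\<forall>s t. 2 * (\<Sum>x\<in>X. \<Sum>y\<in>X. A x y * s x * t y) \<le> (\<Sum>x\<in>X. (s x)\<^sup>2) + (\<Sum>x\<in>X. (t x)\<^sup>2))"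

text \<open>A dual certificate \<open>Q\<close> on two copies of the index set consists of two diagonal blocks \<open>p\<close>, \<open>q\<close> and an
off-diagonal block \<open>B\<close>. Positivity of \<open>Q\<close> means that \<open>B x y / (sqrt (p x) * sqrt (q y))\<close> is a
contraction up to sign; applying the hypothesis on \<open>r\<close> to it and testing against the vectors
\<open>sqrt p\<close> and \<open>sqrt q\<close> gives the inequality that the certificate has to satisfy.\<close>

lemma contractive_schur_imp_pos_def_block:
  fixes r :: "'i \<Rightarrow> 'i \<Rightarrow> real"
  assumes r: "\<And>X A. finite X \<Longrightarrow> contractive_matrix X A \<Longrightarrow> contractive_matrix X (\<lambda>x y. r x y * A x y)"
  shows "\<exists>P :: 'i + 'i \<Rightarrow> 'i + 'i \<Rightarrow> real. pos_def_kernel P \<and> (\<forall>x. P x x = 1) \<and>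
    (\<forall>x y. P (Inl x) (Inr y) = r x y)"
proof -
  define E :: "(('i + 'i) \<times> ('i + 'i)) set"
    where "E = Id \<union> {(Inl x, Inr y) | x y. True} \<union> {(Inr y, Inl x) | x y. True}"
  define g :: "'i + 'i \<Rightarrow> 'i + 'i \<Rightarrow> real"
    where "g = (\<lambda>u v. case (u, v) of (Inl x, Inr y) \<Rightarrow> r x y | (Inr y, Inl x) \<Rightarrow> r x y | _ \<Rightarrow> 1)"
  have "\<exists>P. pos_def_kernel P \<and> (\<forall>(x, y) \<in> E. P x y = g x y)"
  proof (rule pos_def_completion)
    show "sym E" by (auto simp: E_def sym_def)
    show "(u, u) \<in> E" for u by (simp add: E_def)
    show "g u v = g v u" for u v by (auto simp: g_def split: sum.splits)
  next
    fix F and Q :: "'i + 'i \<Rightarrow> 'i + 'i \<Rightarrow> real"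
    assume F: "finite F" and symQ: "\<And>x y. Q x y = Q y x" and posF: "pos_def_on F Q"
      and Q0: "\<And>x y. (x, y) \<notin> E \<inter> F \<times> F \<Longrightarrow> Q x y = 0"
    define X where "X = Inl -` F \<union> Inr -` F"
    have X: "finite X" using F by (auto simp: X_def intro!: finite_vimageI)
    have FX: "F \<subseteq> X <+> X"
    proof
      fix u assume "u \<in> F"
      then show "u \<in> X <+> X" by (cases u) (auto simp: X_def)
    qed
    have finX: "finite (X <+> X)" using X by simp
    define p q B where "p x = Q (Inl x) (Inl x)" and "q x = Q (Inr x) (Inr x)"
      and "B x y = Q (Inl x) (Inr y)" for x y
    have Qdiag: "Q (Inl x) (Inl y) = (if x = y then p x else 0)"
        "Q (Inr x) (Inr y) = (if x = y then q x else 0)" for x y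
      using Q0[of "Inl x" "Inl y"] Q0[of "Inr x" "Inr y"]
      by (fastforce simp: E_def p_def q_def)+
    have expand: "(\<Sum>u\<in>F. \<Sum>v\<in>F. h u v * Q u v) =
        (\<Sum>x\<in>X. h (Inl x) (Inl x) * p x) + (\<Sum>x\<in>X. h (Inr x) (Inr x) * q x) +
        2 * (\<Sum>x\<in>X. \<Sum>y\<in>X. h (Inl x) (Inr y) * B x y)" if h: "\<And>u v. h u v = h v u" for h
    proof -
      have "(\<Sum>u\<in>F. \<Sum>v\<in>F. h u v * Q u v) = (\<Sum>u\<in>X <+> X. \<Sum>v\<in>X <+> X. h u v * Q u v)"
        by (rule sum_square_restrict[OF finX FX, symmetric]) (use Q0 in auto)
      also have "\<dots> = (\<Sum>x\<in>X. h (Inl x) (Inl x) * p x) + (\<Sum>x\<in>X. h (Inr x) (Inr x) * q x) +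
          ((\<Sum>x\<in>X. \<Sum>y\<in>X. h (Inl x) (Inr y) * Q (Inl x) (Inr y)) +
           (\<Sum>x\<in>X. \<Sum>y\<in>X. h (Inr x) (Inl y) * Q (Inr x) (Inl y)))"
        using X by (simp add: sum.Plus sum.distrib Qdiag if_distrib[of "(*) _"] sum.delta' cong: if_cong)
      also have "(\<Sum>x\<in>X. \<Sum>y\<in>X. h (Inr x) (Inl y) * Q (Inr x) (Inl y)) =
          (\<Sum>x\<in>X. \<Sum>y\<in>X. h (Inl x) (Inr y) * Q (Inl x) (Inr y))"
        by (subst sum.swap) (intro sum.cong refl, metis h symQ)
      finally show ?thesis by (simp add: B_def)
    qed
    have quad: "0 \<le> (\<Sum>x\<in>X. (s x)\<^sup>2 * p x) + (\<Sum>x\<in>X. (t x)\<^sup>2 * q x) +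
        2 * (\<Sum>x\<in>X. \<Sum>y\<in>X. s x * t y * B x y)" for s t
    proof -
      have "0 \<le> (\<Sum>u\<in>F. \<Sum>v\<in>F. case_sum s t u * case_sum s t v * Q u v)"
        using posF by (simp add: pos_def_on_def)
      then show ?thesis
        by (subst (asm) expand) (simp_all add: power2_eq_square)
    qed
    have pq: "0 \<le> p x" "0 \<le> q x" for x
      using pos_def_on_diag[OF F posF, of "Inl x"] Q0[of "Inl x" "Inl x"]
        pos_def_on_diag[OF F posF, of "Inr x"] Q0[of "Inr x" "Inr x"]
      unfolding p_def q_def by fastforce+
    have B0: "B x y = 0" if "p x = 0 \<or> q y = 0" for x y
    proof (cases "Inl x \<in> F \<and> Inr y \<in> F")
      case True
      then show ?thesis
        using that pos_def_on_zero_row[OF F posF, of "Inl x" "Inr y"]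
          pos_def_on_zero_row[OF F posF, of "Inr y" "Inl x"] symQ
        unfolding B_def p_def q_def by metis
    qed (use Q0[of "Inl x" "Inr y"] in \<open>auto simp: B_def\<close>)
    define A where "A x y = - B x y / (sqrt (p x) * sqrt (q y))" for x y
    \<comment> \<open>Where a diagonal entry vanishes, so does \<open>B\<close>, and the division by \<open>0\<close> is harmless.\<close>
    have "contractive_matrix X A"
      unfolding contractive_matrix_def
    proof (intro allI)
      fix s t
      have "0 \<le> (\<Sum>x\<in>X. (s x / sqrt (p x))\<^sup>2 * p x) + (\<Sum>x\<in>X. (t x / sqrt (q x))\<^sup>2 * q x) +
        2 * (\<Sum>x\<in>X. \<Sum>y\<in>X. (s x / sqrt (p x)) * (t y / sqrt (q y)) * B x y)" by (rule quad)
      also have "(\<Sum>x\<in>X. (s x / sqrt (p x))\<^sup>2 * p x) \<le> (\<Sum>x\<in>X. (s x)\<^sup>2)"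
        using pq by (intro sum_mono) (simp add: power_divide)
      also have "(\<Sum>x\<in>X. (t x / sqrt (q x))\<^sup>2 * q x) \<le> (\<Sum>x\<in>X. (t x)\<^sup>2)"
        using pq by (intro sum_mono) (simp add: power_divide)
      also have "(\<Sum>x\<in>X. \<Sum>y\<in>X. (s x / sqrt (p x)) * (t y / sqrt (q y)) * B x y) =
          - (\<Sum>x\<in>X. \<Sum>y\<in>X. A x y * s x * t y)"
        unfolding sum_negf[symmetric] by (intro sum.cong refl) (simp add: A_def)
      finally show "2 * (\<Sum>x\<in>X. \<Sum>y\<in>X. A x y * s x * t y) \<le> (\<Sum>x\<in>X. (s x)\<^sup>2) + (\<Sum>x\<in>X. (t x)\<^sup>2)"
        by simp
    qed
    from r[OF X this]
    have "2 * (\<Sum>x\<in>X. \<Sum>y\<in>X. r x y * A x y * sqrt (p x) * sqrt (q y)) \<le>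
        (\<Sum>x\<in>X. (sqrt (p x))\<^sup>2) + (\<Sum>x\<in>X. (sqrt (q x))\<^sup>2)"
      unfolding contractive_matrix_def by (rule allE) (erule allE)
    also have "\<dots> = (\<Sum>x\<in>X. p x) + (\<Sum>x\<in>X. q x)" using pq by simp
    also have "(\<Sum>x\<in>X. \<Sum>y\<in>X. r x y * A x y * sqrt (p x) * sqrt (q y)) = - (\<Sum>x\<in>X. \<Sum>y\<in>X. r x y * B x y)"
      unfolding sum_negf[symmetric] by (intro sum.cong refl) (auto simp: A_def B0)
    finally have "0 \<le> (\<Sum>x\<in>X. p x) + (\<Sum>x\<in>X. q x) + 2 * (\<Sum>x\<in>X. \<Sum>y\<in>X. r x y * B x y)"
      by simp
    also have "\<dots> = (\<Sum>u\<in>F. \<Sum>v\<in>F. g u v * Q u v)"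
      by (subst expand) (auto simp: g_def split: sum.splits)
    finally show "0 \<le> (\<Sum>u\<in>F. \<Sum>v\<in>F. Q u v * g u v)"
      by (simp add: mult.commute)
  qed
  then obtain P where P: "pos_def_kernel P" "\<And>x y. (x, y) \<in> E \<Longrightarrow> P x y = g x y" by fast
  have "P u u = 1" for u using P(2)[of u u] by (cases u) (auto simp: E_def g_def)
  moreover have "P (Inl x) (Inr y) = r x y" for x y
    using P(2)[of "Inl x" "Inr y"] by (auto simp: E_def g_def)
  ultimately show ?thesis using P(1) by blast
qed

section \<open>Realisation of positive definite kernels by vectors\<close>

lemmas ell2_nth_simps [simp] = zero_ell2.rep_eq plus_ell2.rep_eq uminus_ell2.rep_eq minus_ell2.rep_eq
  scaleR_ell2.rep_eq ell2_scale.rep_eq ell2_basis.rep_eq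

lemma has_sum_inner_ell2: "((\<lambda>i. inner (ell2_nth f i) (ell2_nth g i)) has_sum inner f g) UNIV"
  unfolding inner_ell2_def
  by (rule has_sum_infsum[OF square_summable_inner[OF ell2_summable ell2_summable]])

lemma has_sum_norm_ell2: "((\<lambda>i. (cmod (ell2_nth f i))\<^sup>2) has_sum (norm f)\<^sup>2) UNIV"
  unfolding norm_ell2_square by (rule has_sum_infsum[OF ell2_summable])

lemma bounded_linear_ell2_nth: "bounded_linear (\<lambda>f. ell2_nth f i)"
  by (rule bounded_linear_intro[where K = 1]) (auto simp: cmod_le_norm_ell2)

lemma inner_ell2_basis: "inner f (ell2_basis j) = Re (ell2_nth f j)"
proof (rule has_sum_unique[OF has_sum_inner_ell2])
  show "((\<lambda>i. inner (ell2_nth f i) (ell2_nth (ell2_basis j) i)) has_sum Re (ell2_nth f j)) UNIV"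
    by (rule has_sum_finite_neutralI[of "{j}"]) (auto simp: inner_complex_def)
qed

lemma norm_ell2_basis [simp]: "norm (ell2_basis j) = 1"
  by (simp add: norm_eq_sqrt_inner inner_ell2_basis)

lemma has_sum_finite_sum:
  fixes f :: "'a \<Rightarrow> 'b \<Rightarrow> 'c::topological_comm_monoid_add"
  assumes "\<And>a. a \<in> F \<Longrightarrow> (f a has_sum s a) B"
  shows "((\<lambda>b. \<Sum>a\<in>F. f a b) has_sum (\<Sum>a\<in>F. s a)) B"
  using assms by (induction F rule: infinite_finite_induct) (auto intro: has_sum_add)

text \<open>The Riesz representation theorem for a functional that is given by its graph \<open>L\<close> on a subspace which
need not be closed. The bound \<open>2 * a \<le> C + (norm z)\<^sup>2\<close> is the form in which positive definiteness
provides boundedness; the representing vector \<open>w\<close> is the limit of a sequence minimising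
\<open>(norm z)\<^sup>2 - 2 * a\<close> over the graph.\<close>

lemma riesz_representation_graph:
  fixes L :: "('h::{real_inner, complete_space} \<times> real) set"
  assumes L: "subspace L" and bd: "\<And>z a. (z, a) \<in> L \<Longrightarrow> 2 * a \<le> C + (norm z)\<^sup>2"
  shows "\<exists>w \<in> closure (fst ` L). (\<forall>(z, a) \<in> L. inner w z = a) \<and> (norm w)\<^sup>2 \<le> C"
proof -
  define q :: "'h \<times> real \<Rightarrow> real" where "q p = (norm (fst p))\<^sup>2 - 2 * snd p" for p
  define d where "d = Inf (q ` L)"
  have bdd: "bdd_below (q ` L)"
    by (rule bdd_belowI2[of _ "- C"]) (use bd in \<open>force simp: q_def\<close>)
  have d: "d \<le> q p" if "p \<in> L" for p
    unfolding d_def by (rule cINF_lower[OF bdd that])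
  have "\<exists>p. p \<in> L \<and> q p < d + inverse (real (Suc n))" for n
  proof -
    have "q ` L \<noteq> {}" using subspace_0[OF L] by blast
    then have "\<exists>r\<in>q ` L. r < d + inverse (real (Suc n))"
      using bdd unfolding d_def by (subst cInf_less_iff[symmetric]) auto
    then show ?thesis by blast
  qed
  then obtain p where p: "\<And>n. p n \<in> L" "\<And>n. q (p n) < d + inverse (real (Suc n))" by metis
  have qlim: "(\<lambda>n. q (p n)) \<longlonglongrightarrow> d"
  proof (rule tendsto_sandwich[OF _ _ tendsto_const])
    show "(\<lambda>n. d + inverse (real (Suc n))) \<longlonglongrightarrow> d"
      using tendsto_add[OF tendsto_const[of d] LIMSEQ_inverse_real_of_nat] by simp
  qed (use d p in \<open>auto intro!: always_eventually less_imp_le\<close>)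
  \<comment> \<open>By the parallelogram law, a minimising sequence is Cauchy.\<close>
  have par: "(norm (fst (p m) - fst (p n)))\<^sup>2 \<le> 2 * (q (p m) - d) + 2 * (q (p n) - d)" for m n
  proof -
    have "d \<le> q ((1/2) *\<^sub>R (p m + p n))"
      by (intro d subspace_scale[OF L] subspace_add[OF L] p)
    moreover have "(norm (fst (p m) - fst (p n)))\<^sup>2 =
        2 * q (p m) + 2 * q (p n) - 4 * q ((1/2) *\<^sub>R (p m + p n))"
      unfolding q_def power2_norm_eq_inner
      by (simp add: inner_add_left inner_add_right inner_diff_left inner_diff_right algebra_simps)
    ultimately show ?thesis by simp
  qed
  have "Cauchy (\<lambda>n. fst (p n))"
    unfolding Cauchy_def dist_norm
  proof (intro allI impI)
    fix e :: real assume e: "0 < e"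
    then have "\<forall>\<^sub>F n in sequentially. q (p n) < d + e\<^sup>2 / 4"
      by (intro order_tendstoD[OF qlim]) simp
    then obtain N where N: "\<And>n. n \<ge> N \<Longrightarrow> q (p n) < d + e\<^sup>2 / 4"
      unfolding eventually_sequentially by blast
    have "norm (fst (p m) - fst (p n)) < e" if "m \<ge> N" "n \<ge> N" for m n
    proof -
      have "(norm (fst (p m) - fst (p n)))\<^sup>2 < e\<^sup>2"
        using par[of m n] N[OF that(1)] N[OF that(2)] by argo
      then show ?thesis using e by (simp add: power2_less_imp_less)
    qed
    then show "\<exists>M. \<forall>m\<ge>M. \<forall>n\<ge>M. norm (fst (p m) - fst (p n)) < e" by blast
  qed
  then obtain w where w: "(\<lambda>n. fst (p n)) \<longlonglongrightarrow> w"
    using Cauchy_convergent convergent_def by blast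
  have le: "0 \<le> inner w z - a" if za: "(z, a) \<in> L" for z a
  proof (rule first_variation_nonneg)
    fix t :: real
    have "(\<lambda>n. q (p n) + 2 * t * (inner (fst (p n)) z - a) + t\<^sup>2 * (norm z)\<^sup>2)
        \<longlonglongrightarrow> d + 2 * t * (inner w z - a) + t\<^sup>2 * (norm z)\<^sup>2"
      by (intro tendsto_intros qlim w)
    moreover have "d \<le> q (p n) + 2 * t * (inner (fst (p n)) z - a) + t\<^sup>2 * (norm z)\<^sup>2" for n
    proof -
      have "d \<le> q (p n + t *\<^sub>R (z, a))"
        by (intro d subspace_scale[OF L] subspace_add[OF L] p za)
      also have "\<dots> = q (p n) + 2 * t * (inner (fst (p n)) z - a) + t\<^sup>2 * (norm z)\<^sup>2"
        unfolding q_def power2_norm_eq_inner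
        by (simp add: inner_add_left inner_add_right inner_commute power2_eq_square algebra_simps)
      finally show ?thesis .
    qed
    ultimately have "d \<le> d + 2 * t * (inner w z - a) + t\<^sup>2 * (norm z)\<^sup>2"
      by (intro LIMSEQ_le_const) auto
    then show "0 \<le> 2 * t * (inner w z - a) + t\<^sup>2 * (norm z)\<^sup>2" by simp
  qed
  have eq: "inner w z = a" if "(z, a) \<in> L" for z a
    using le[OF that] le[of "- z" "- a"] subspace_neg[OF L that] by simp
  have "(norm w)\<^sup>2 \<le> C"
  proof -
    have "2 * inner w (fst (p n)) \<le> C + (norm (fst (p n)))\<^sup>2" for n
      using bd[of "fst (p n)" "snd (p n)"] eq[of "fst (p n)" "snd (p n)"] p(1)[of n] by simp
    moreover have "(\<lambda>n. 2 * inner w (fst (p n))) \<longlonglongrightarrow> 2 * inner w w"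
        "(\<lambda>n. C + (norm (fst (p n)))\<^sup>2) \<longlonglongrightarrow> C + (norm w)\<^sup>2"
      by (intro tendsto_intros w)+
    ultimately have "2 * inner w w \<le> C + (norm w)\<^sup>2"
      using LIMSEQ_le by blast
    then show ?thesis by (simp add: power2_norm_eq_inner)
  qed
  moreover have "w \<in> closure (fst ` L)"
    unfolding closure_sequential using p(1) w by (intro exI[of _ "\<lambda>n. fst (p n)"]) auto
  ultimately show ?thesis using eq by blast
qed

text \<open>One step of the construction of a Gram representation: \<open>w\<close> is the orthogonal projection, on the closed
span of the vectors found so far, of the vector that is to represent the new point \<open>x\<close>.\<close>

lemma pos_def_kernel_extension:
  fixes v :: "'i \<Rightarrow> 'h::{real_inner, complete_space}"
  assumes k: "pos_def_kernel k" and v: "\<And>s t. s \<in> S \<Longrightarrow> t \<in> S \<Longrightarrow> inner (v s) (v t) = k s t"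
    and x: "x \<notin> S"
  obtains w where "w \<in> closure (span (v ` S))" "\<And>s. s \<in> S \<Longrightarrow> inner w (v s) = k x s"
    "(norm w)\<^sup>2 \<le> k x x"
proof -
  define h where "h s = (v s, k x s)" for s
  have sub: "subspace (span (h ` S))" by simp
  have fst: "fst ` span (h ` S) = span (v ` S)"
    using linear_span_image[OF bounded_linear.linear[OF bounded_linear_fst], of "h ` S"]
    by (simp add: image_image h_def)
  have bd: "2 * a \<le> k x x + (norm z)\<^sup>2" if "(z, a) \<in> span (h ` S)" for z a
  proof -
    from that obtain T r where T: "finite T" "T \<subseteq> h ` S" "(z, a) = (\<Sum>b\<in>T. r b *\<^sub>R b)"
      unfolding span_explicit by blast
    from T(2) obtain U where U: "U \<subseteq> S" "inj_on h U" "T = h ` U"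
      by (auto simp: subset_image_inj)
    have finU: "finite U" using T(1) U by (simp add: finite_image_iff)
    define c where "c s = r (h s)" for s
    have "(z, a) = (\<Sum>s\<in>U. c s *\<^sub>R h s)"
      unfolding T(3) U(3) by (subst sum.reindex[OF U(2)]) (simp add: c_def)
    then have z: "z = (\<Sum>s\<in>U. c s *\<^sub>R v s)" and a: "a = (\<Sum>s\<in>U. c s * k x s)"
      by (simp_all add: prod_eq_iff fst_sum snd_sum h_def)
    have xU: "x \<notin> U" using U x by blast
    define d where "d = c(x := -1)"
    have dx: "d x = -1" by (simp add: d_def)
    have dU: "d s = c s" if "s \<in> U" for s using that xU by (auto simp: d_def)
    have sym: "k s x = k x s" for s using k by (simp add: pos_def_kernel_def)
    have "0 \<le> (\<Sum>s\<in>insert x U. \<Sum>t\<in>insert x U. d s * d t * k s t)"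
      using k finU unfolding pos_def_kernel_def pos_def_on_def by blast
    also have "\<dots> = (\<Sum>s\<in>insert x U. d s * (\<Sum>t\<in>insert x U. d t * k s t))"
      by (simp only: sum_distrib_left mult.assoc)
    also have "\<dots> = (\<Sum>s\<in>insert x U. d s * ((\<Sum>t\<in>U. c t * k s t) - k x s))"
    proof (intro sum.cong refl arg_cong2[where f = "(*)"])
      fix s
      have "(\<Sum>t\<in>insert x U. d t * k s t) = d x * k s x + (\<Sum>t\<in>U. d t * k s t)"
        by (rule sum.insert[OF finU xU])
      then show "(\<Sum>t\<in>insert x U. d t * k s t) = (\<Sum>t\<in>U. c t * k s t) - k x s"
        by (simp add: dx dU sym[of s])
    qed
    also have "\<dots> = d x * ((\<Sum>t\<in>U. c t * k x t) - k x x) +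
        (\<Sum>s\<in>U. d s * ((\<Sum>t\<in>U. c t * k s t) - k x s))"
      by (rule sum.insert[OF finU xU])
    also have "(\<Sum>s\<in>U. d s * ((\<Sum>t\<in>U. c t * k s t) - k x s)) =
        (\<Sum>s\<in>U. c s * (\<Sum>t\<in>U. c t * k s t) - c s * k x s)"
      by (intro sum.cong refl) (simp add: dU right_diff_distrib)
    also have "\<dots> = (\<Sum>s\<in>U. \<Sum>t\<in>U. c s * c t * k s t) - a"
      by (simp only: sum_subtractf a sum_distrib_left mult.assoc)
    also have "d x * ((\<Sum>t\<in>U. c t * k x t) - k x x) = k x x - a"
      by (simp add: dx a)
    also have "(\<Sum>s\<in>U. \<Sum>t\<in>U. c s * c t * k s t) = (norm z)\<^sup>2"
      unfolding z power2_norm_eq_inner inner_sum_left inner_sum_right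
      using U(1) v k by (intro sum.cong refl) (auto simp: mult.assoc subset_eq pos_def_kernel_def)
    finally show ?thesis by simp
  qed
  have "\<exists>w \<in> closure (fst ` span (h ` S)). (\<forall>(z, a) \<in> span (h ` S). inner w z = a) \<and> (norm w)\<^sup>2 \<le> k x x"
    by (rule riesz_representation_graph[OF sub bd])
  then obtain w where w: "w \<in> closure (span (v ` S))" "(norm w)\<^sup>2 \<le> k x x"
      "\<forall>(z, a) \<in> span (h ` S). inner w z = a"
    unfolding fst by blast
  have "inner w (v s) = k x s" if "s \<in> S" for s
    using bspec[OF w(3) span_base[of "h s"]] that by (simp add: h_def)
  then show ?thesis by (rule that[OF w(1) _ w(2)])
qed

text \<open>The copy of the real space \<open>\<ell>\<^sup>2(T)\<close> inside the complex space \<open>\<ell>\<^sup>2\<close>.\<close>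

definition real_vectors_on :: "'j set \<Rightarrow> 'j ell2 set"
  where "real_vectors_on T = {f. \<forall>j. Im (ell2_nth f j) = 0 \<and> (j \<notin> T \<longrightarrow> ell2_nth f j = 0)}"

lemma subspace_real_vectors_on: "subspace (real_vectors_on T)"
  by (rule subspaceI) (auto simp: real_vectors_on_def)

lemma closed_real_vectors_on: "closed (real_vectors_on T)"
proof -
  have *: "continuous_on UNIV (\<lambda>f. ell2_nth f j)" for j :: 'a
    by (rule bounded_linear.continuous_on[OF bounded_linear_ell2_nth]) (rule continuous_on_id)
  have **: "closed {f. j \<notin> T \<longrightarrow> ell2_nth f j = 0}" for j
    by (cases "j \<in> T") (auto intro!: closed_Collect_eq *)
  show ?thesis
    unfolding real_vectors_on_def
    by (intro closed_Collect_all closed_Collect_conj closed_Collect_eq ** continuous_intros *)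
qed

text \<open>The vectors are built by transfinite Gram-Schmidt orthogonalisation: a maximal partial representation,
stored as its graph and using only the coordinates that belong to its domain, is total, since a new point
\<open>x\<close> is represented by its projection \<open>w\<close> plus a multiple of the unused basis vector at \<open>\<iota> x\<close>. Real
coordinates make the coordinate expansion of the kernel a sum of real rank one kernels.\<close>

theorem kolmogorov_decomposition:
  fixes k :: "'i \<Rightarrow> 'i \<Rightarrow> real" and \<iota> :: "'i \<Rightarrow> 'j"
  assumes k: "pos_def_kernel k" and \<iota>: "inj \<iota>"
  obtains v :: "'i \<Rightarrow> 'j ell2" where "\<And>x y. inner (v x) (v y) = k x y"
    "\<And>x j. Im (ell2_nth (v x) j) = 0"
proof -
  define \<A> where "\<A> = {G :: ('i \<times> 'j ell2) set.
      (\<forall>(s, f) \<in> G. f \<in> real_vectors_on (\<iota> ` Domain G)) \<and>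
      (\<forall>(s, f) \<in> G. \<forall>(t, g) \<in> G. inner f g = k s t)}"
  have "\<exists>G\<in>\<A>. \<forall>X\<in>\<A>. G \<subseteq> X \<longrightarrow> X = G"
  proof (rule subset_Zorn')
    fix C assume C: "subset.chain \<A> C"
    have mono: "real_vectors_on T \<subseteq> real_vectors_on T'" if "T \<subseteq> T'" for T T' :: "'j set"
      using that by (auto simp: real_vectors_on_def)
    show "\<Union>C \<in> \<A>"
      unfolding \<A>_def
    proof (intro CollectI conjI ballI; clarify)
      fix s f G assume "(s, f) \<in> G" "G \<in> C"
      then have "f \<in> real_vectors_on (\<iota> ` Domain G)"
        using C by (auto simp: subset_chain_def \<A>_def)
      then show "f \<in> real_vectors_on (\<iota> ` Domain (\<Union>C))"
        by (rule subsetD[OF mono, rotated]) (use \<open>G \<in> C\<close> in blast)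
    next
      fix s f t g G G' assume G: "(s, f) \<in> G" "G \<in> C" and G': "(t, g) \<in> G'" "G' \<in> C"
      have "G \<subseteq> G' \<or> G' \<subseteq> G"
        using C G(2) G'(2) by (auto simp: subset_chain_def)
      then obtain H where "H \<in> C" "G \<subseteq> H" "G' \<subseteq> H"
        using G(2) G'(2) by auto
      then have "H \<in> \<A>" "(s, f) \<in> H" "(t, g) \<in> H" using G G' C by (auto simp: subset_chain_def)
      then show "inner f g = k s t" unfolding \<A>_def by fast
    qed
  qed
  then obtain G where G: "G \<in> \<A>" and max: "\<And>X. X \<in> \<A> \<Longrightarrow> G \<subseteq> X \<Longrightarrow> X = G" by blast
  define v where "v s = (SOME f. (s, f) \<in> G)" for s
  have v: "(s, v s) \<in> G" if "s \<in> Domain G" for s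
    using that unfolding v_def by (auto intro: someI)
  have gram: "inner f g = k s t" if "(s, f) \<in> G" "(t, g) \<in> G" for s f t g
    using G that unfolding \<A>_def by fast
  have supp: "f \<in> real_vectors_on (\<iota> ` Domain G)" if "(s, f) \<in> G" for s f
    using G that unfolding \<A>_def by fast
  have "x \<in> Domain G" for x
  proof (rule ccontr)
    assume x: "x \<notin> Domain G"
    obtain w where w: "w \<in> closure (span (v ` Domain G))"
        "\<And>s. s \<in> Domain G \<Longrightarrow> inner w (v s) = k x s" "(norm w)\<^sup>2 \<le> k x x"
      using pos_def_kernel_extension[OF k _ x, of v] gram v by metis
    have "closure (span (v ` Domain G)) \<subseteq> real_vectors_on (\<iota> ` Domain G)"
      using supp v
      by (intro closure_minimal span_minimal closed_real_vectors_on subspace_real_vectors_on) blast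
    with w(1) have wr: "w \<in> real_vectors_on (\<iota> ` Domain G)" by blast
    have xn: "\<iota> x \<notin> \<iota> ` Domain G" using x \<iota> by (auto dest: injD)
    \<comment> \<open>The fresh basis vector at \<open>\<iota> x\<close> is orthogonal to everything constructed so far.\<close>
    have orth: "inner f (ell2_basis (\<iota> x)) = 0" if "f \<in> real_vectors_on (\<iota> ` Domain G)" for f
      using that xn by (simp add: inner_ell2_basis real_vectors_on_def)
    \<comment> \<open>The coefficient makes the squared norm equal to \<open>k x x\<close>; the root is real because \<open>(norm w)\<^sup>2 \<le> k x x\<close>.\<close>
    define f0 where "f0 = w + sqrt (k x x - (norm w)\<^sup>2) *\<^sub>R ell2_basis (\<iota> x)"
    have f0x: "inner f0 f0 = k x x"
      using w(3) orth[OF wr] unfolding f0_def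
      by (simp add: inner_add_left inner_add_right inner_commute[of "ell2_basis _" w]
          inner_ell2_basis power2_norm_eq_inner flip: real_sqrt_mult)
    have f0: "inner f0 f = k x s" "inner f f0 = k s x" if "(s, f) \<in> G" for s f
    proof -
      have "v s = f"
      proof -
        have s: "s \<in> Domain G" using that by blast
        have "inner (v s - f) (v s - f) = 0"
          using gram[OF that that] gram[OF v[OF s] v[OF s]] gram[OF v[OF s] that] gram[OF that v[OF s]]
          by (simp add: inner_diff_left inner_diff_right)
        then show ?thesis by simp
      qed
      then have "inner w f = k x s" using w(2)[of s] that by blast
      moreover have "inner (ell2_basis (\<iota> x)) f = 0"
        using orth[OF supp[OF that]] by (simp add: inner_commute)
      ultimately show "inner f0 f = k x s" by (simp add: f0_def inner_add_left)
      then show "inner f f0 = k s x" using k by (simp add: inner_commute pos_def_kernel_def)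
    qed
    have "insert (x, f0) G \<in> \<A>"
      unfolding \<A>_def
    proof (intro CollectI conjI ballI; clarify)
      fix s f assume "(s, f) \<in> insert (x, f0) G"
      then show "f \<in> real_vectors_on (\<iota> ` Domain (insert (x, f0) G))"
      proof
        assume "(s, f) = (x, f0)"
        with wr show ?thesis by (auto simp: real_vectors_on_def f0_def)
      next
        assume "(s, f) \<in> G"
        from supp[OF this] show ?thesis by (auto simp: real_vectors_on_def)
      qed
    next
      fix s f t g assume "(s, f) \<in> insert (x, f0) G" "(t, g) \<in> insert (x, f0) G"
      then show "inner f g = k s t" using f0x f0 gram by auto
    qed
    from max[OF this] x show False by blast
  qed
  then have "(s, v s) \<in> G" for s by (rule v)
  then show ?thesis
    using gram supp[unfolded real_vectors_on_def] by (intro that[of v]) blast+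
qed

lemma pos_def_kernel_sym: "pos_def_kernel k \<Longrightarrow> k x y = k y x"
  by (simp add: pos_def_kernel_def)

lemma pos_def_kernel_nonneg:
  "pos_def_kernel k \<Longrightarrow> finite F \<Longrightarrow> 0 \<le> (\<Sum>x\<in>F. \<Sum>y\<in>F. c x * c y * k x y)"
  by (simp add: pos_def_kernel_def pos_def_on_def)

lemma pos_def_kernelI:
  assumes "\<And>x y. k x y = k y x"
    and "\<And>F c. finite F \<Longrightarrow> 0 \<le> (\<Sum>x\<in>F. \<Sum>y\<in>F. c x * c y * k x y)"
  shows "pos_def_kernel k"
  using assms by (simp add: pos_def_kernel_def pos_def_on_def)

lemma pos_def_kernel_gram:
  fixes u :: "'i \<Rightarrow> 'h::real_inner"
  shows "pos_def_kernel (\<lambda>x y. inner (u x) (u y))"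
proof (rule pos_def_kernelI)
  fix F :: "'i set" and c
  have "(\<Sum>x\<in>F. \<Sum>y\<in>F. c x * c y * inner (u x) (u y)) =
      inner (\<Sum>x\<in>F. c x *\<^sub>R u x) (\<Sum>y\<in>F. c y *\<^sub>R u y)"
    unfolding inner_sum_left inner_sum_right by (intro sum.cong refl) (simp add: inner_commute)
  then show "0 \<le> (\<Sum>x\<in>F. \<Sum>y\<in>F. c x * c y * inner (u x) (u y))" by simp
qed (rule inner_commute)

lemma pos_def_kernel_lim:
  assumes "\<And>n. pos_def_kernel (k n)" "\<And>x y. (\<lambda>n. k n x y) \<longlonglongrightarrow> l x y"
  shows "pos_def_kernel l"
proof (rule pos_def_kernelI)
  show "l x y = l y x" for x y
  proof (rule LIMSEQ_unique[OF assms(2)[of x y]])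
    show "(\<lambda>n. k n x y) \<longlonglongrightarrow> l y x"
      using assms(2)[of y x] by (simp only: pos_def_kernel_sym[OF assms(1), of _ y x])
  qed
  show "0 \<le> (\<Sum>x\<in>F. \<Sum>y\<in>F. c x * c y * l x y)" if "finite F" for F c
  proof (rule LIMSEQ_le_const)
    show "(\<lambda>n. \<Sum>x\<in>F. \<Sum>y\<in>F. c x * c y * k n x y) \<longlonglongrightarrow> (\<Sum>x\<in>F. \<Sum>y\<in>F. c x * c y * l x y)"
      by (intro tendsto_intros assms(2))
  qed (use pos_def_kernel_nonneg[OF assms(1) that] in blast)
qed

lemma pos_def_kernel_mult_nonneg:
  assumes "pos_def_kernel k" "0 \<le> a"
  shows "pos_def_kernel (\<lambda>x y. a * k x y)"
proof (rule pos_def_kernelI)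
  fix F :: "'a set" and c assume "finite F"
  then have "0 \<le> a * (\<Sum>x\<in>F. \<Sum>y\<in>F. c x * c y * k x y)"
    using assms pos_def_kernel_nonneg by (intro mult_nonneg_nonneg)
  then show "0 \<le> (\<Sum>x\<in>F. \<Sum>y\<in>F. c x * c y * (a * k x y))"
    by (simp add: sum_distrib_left mult_ac)
qed (simp add: pos_def_kernel_sym[OF assms(1)])

lemma pos_def_kernel_sum:
  assumes "\<And>a. a \<in> A \<Longrightarrow> pos_def_kernel (k a)"
  shows "pos_def_kernel (\<lambda>x y. \<Sum>a\<in>A. k a x y)"
proof (rule pos_def_kernelI)
  show "(\<Sum>a\<in>A. k a x y) = (\<Sum>a\<in>A. k a y x)" for x y
    by (intro sum.cong refl pos_def_kernel_sym assms)
  fix F :: "'b set" and c assume F: "finite F"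
  have "0 \<le> (\<Sum>a\<in>A. \<Sum>x\<in>F. \<Sum>y\<in>F. c x * c y * k a x y)"
    by (intro sum_nonneg pos_def_kernel_nonneg[OF assms F])
  also have "\<dots> = (\<Sum>x\<in>F. \<Sum>y\<in>F. c x * c y * (\<Sum>a\<in>A. k a x y))"
    by (subst sum.swap, intro sum.cong refl, subst sum.swap) (simp add: sum_distrib_left)
  finally show "0 \<le> (\<Sum>x\<in>F. \<Sum>y\<in>F. c x * c y * (\<Sum>a\<in>A. k a x y))" .
qed

text \<open>The Schur product theorem: expanding \<open>k\<close> in coordinates writes the quadratic form of the product as a
sum of values of the quadratic form of \<open>l\<close>.\<close>

lemma pos_def_kernel_mult:
  assumes k: "pos_def_kernel k" and l: "pos_def_kernel l"
  shows "pos_def_kernel (\<lambda>x y. k x y * l x y)"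
proof (rule pos_def_kernelI)
  fix F :: "'a set" and c assume F: "finite F"
  obtain v :: "'a \<Rightarrow> 'a ell2" where v: "\<And>x y. inner (v x) (v y) = k x y"
      "\<And>x i. Im (ell2_nth (v x) i) = 0"
    using kolmogorov_decomposition[OF k inj_on_id] by blast
  define r where "r x i = Re (ell2_nth (v x) i)" for x i
  have "((\<lambda>i. r x i * r y i) has_sum k x y) UNIV" for x y
    using has_sum_inner_ell2[of "v x" "v y"] by (simp add: v r_def inner_complex_def)
  then have "((\<lambda>i. \<Sum>x\<in>F. \<Sum>y\<in>F. (c x * c y * l x y) * (r x i * r y i)) has_sum
      (\<Sum>x\<in>F. \<Sum>y\<in>F. (c x * c y * l x y) * k x y)) UNIV"
    by (intro has_sum_finite_sum has_sum_cmult_right)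
  moreover have "0 \<le> (\<Sum>x\<in>F. \<Sum>y\<in>F. (c x * c y * l x y) * (r x i * r y i))" for i
    using pos_def_kernel_nonneg[OF l F, of "\<lambda>x. c x * r x i"] by (simp add: mult_ac)
  ultimately have "0 \<le> (\<Sum>x\<in>F. \<Sum>y\<in>F. (c x * c y * l x y) * k x y)"
    by (rule has_sum_nonneg)
  then show "0 \<le> (\<Sum>x\<in>F. \<Sum>y\<in>F. c x * c y * (k x y * l x y))" by (simp add: mult_ac)
qed (simp add: pos_def_kernel_sym[OF k] pos_def_kernel_sym[OF l])

lemma pos_def_kernel_power:
  assumes "pos_def_kernel k"
  shows "pos_def_kernel (\<lambda>x y. k x y ^ n)"
proof (induction n)
  case 0
  show ?case using pos_def_kernel_gram[of "\<lambda>_. 1 :: real"] by simp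
next
  case (Suc n)
  then show ?case using pos_def_kernel_mult[OF assms] by simp
qed

lemma pos_def_kernel_exp:
  assumes "pos_def_kernel k"
  shows "pos_def_kernel (\<lambda>x y. exp (k x y))"
proof (rule pos_def_kernel_lim)
  show "pos_def_kernel (\<lambda>x y. \<Sum>i<n. inverse (fact i) * k x y ^ i)" for n
    by (intro pos_def_kernel_sum pos_def_kernel_mult_nonneg pos_def_kernel_power assms) simp
  show "(\<lambda>n. \<Sum>i<n. inverse (fact i) * k x y ^ i) \<longlonglongrightarrow> exp (k x y)" for x y
    using exp_converges[of "k x y"] by (simp add: sums_def divide_inverse)
qed

text \<open>Schoenberg's theorem: up to factors that depend on \<open>x\<close> or \<open>y\<close> only, the Gaussian kernel is the
exponential of a Gram kernel.\<close>

theorem pos_def_kernel_gaussian: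
  fixes u :: "'i \<Rightarrow> 'h::real_inner"
  assumes "0 \<le> t"
  shows "pos_def_kernel (\<lambda>x y. exp (- t * (norm (u x - u y))\<^sup>2))"
proof -
  define f where "f x = exp (- t * (norm (u x))\<^sup>2)" for x
  have "pos_def_kernel (\<lambda>x y. inner (f x) (f y) * exp ((2 * t) * inner (u x) (u y)))"
    using assms
    by (intro pos_def_kernel_mult[OF pos_def_kernel_gram] pos_def_kernel_exp
        pos_def_kernel_mult_nonneg[OF pos_def_kernel_gram]) simp
  moreover have "exp (- t * (norm (u x - u y))\<^sup>2) = inner (f x) (f y) * exp ((2 * t) * inner (u x) (u y))"
    for x y
    by (simp add: f_def power2_norm_eq_inner inner_diff_left inner_diff_right
        inner_commute[of "u y" "u x"] algebra_simps flip: exp_add)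
  ultimately show ?thesis by simp
qed

section \<open>Schur multipliers of norm at most one\<close>

lemma ell2_nth_sum: "ell2_nth (sum f F) x = (\<Sum>a\<in>F. ell2_nth (f a) x)"
  by (induction F rule: infinite_finite_induct) auto

lemma norm_ell2_finite_support:
  assumes "finite X" "\<And>x. x \<notin> X \<Longrightarrow> ell2_nth f x = 0"
  shows "(norm f)\<^sup>2 = (\<Sum>x\<in>X. (cmod (ell2_nth f x))\<^sup>2)"
proof (rule has_sum_unique[OF has_sum_norm_ell2])
  show "((\<lambda>i. (cmod (ell2_nth f i))\<^sup>2) has_sum (\<Sum>x\<in>X. (cmod (ell2_nth f x))\<^sup>2)) UNIV"
    by (rule has_sum_finite_neutralI[OF assms(1)]) (auto simp: assms(2))
qed

lemma ell2_finite_approximation: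
  assumes "0 < e"
  obtains F where "finite F" "norm ((\<Sum>i\<in>F. ell2_scale (ell2_nth f i) (ell2_basis i)) - f) < e"
proof -
  obtain F where F: "finite F" "dist (\<Sum>i\<in>F. (cmod (ell2_nth f i))\<^sup>2) ((norm f)\<^sup>2) \<le> (e/2)\<^sup>2"
    using has_sum_finite_approximation[OF has_sum_norm_ell2[of f], of "(e/2)\<^sup>2"] assms by auto
  let ?g = "(\<Sum>i\<in>F. ell2_scale (ell2_nth f i) (ell2_basis i)) - f"
  have nth: "ell2_nth ?g i = (if i \<in> F then 0 else - ell2_nth f i)" for i
    using F(1) by (simp add: ell2_nth_sum if_distrib[of "(*) _"] sum.delta' cong: if_cong)
  have "((\<lambda>i. if i \<in> F then (cmod (ell2_nth f i))\<^sup>2 else 0) has_sum (\<Sum>i\<in>F. (cmod (ell2_nth f i))\<^sup>2)) UNIV"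
    by (rule has_sum_finite_neutralI[OF F(1)]) auto
  from has_sum_add[OF this has_sum_norm_ell2[of ?g]]
  have "((\<lambda>i. (cmod (ell2_nth f i))\<^sup>2) has_sum (\<Sum>i\<in>F. (cmod (ell2_nth f i))\<^sup>2) + (norm ?g)\<^sup>2) UNIV"
    by (rule has_sum_cong[THEN iffD1, rotated]) (simp only: nth, simp)
  from has_sum_unique[OF this has_sum_norm_ell2]
  have "(norm ?g)\<^sup>2 \<le> (e/2)\<^sup>2" using F(2) by (simp add: dist_real_def)
  then have "norm ?g \<le> e/2" by (rule power2_le_imp_le) (use assms in simp)
  then show ?thesis using that[OF F(1)] assms by simp
qed

text \<open>The finite linear combinations of basis vectors are dense. This is why the description in
\<open>schur_map\<close> is unique, and any operator with the required matrix computes it.\<close>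

lemma bounded_op_eqI:
  assumes B: "bounded_op B" and C: "bounded_op C"
    and eq: "\<And>x y. matrix_entry B x y = matrix_entry C x y"
  shows "B = C"
proof
  fix f
  have lin: "bounded_linear B" "bounded_linear C" using B C by (auto simp: bounded_op_def)
  let ?Z = "{f. B f = C f}"
  have "closed ?Z"
    by (intro closed_Collect_eq bounded_linear.continuous_on[OF lin(1)]
      bounded_linear.continuous_on[OF lin(2)] continuous_on_id)
  moreover have "f \<in> closure ?Z"
    unfolding closure_approachable
  proof (intro allI impI)
    fix e :: real assume "0 < e"
    then obtain F where F: "finite F" "norm ((\<Sum>i\<in>F. ell2_scale (ell2_nth f i) (ell2_basis i)) - f) < e"
      by (rule ell2_finite_approximation)
    have "B (ell2_basis i) = C (ell2_basis i)" for i
      using eq by (intro ell2_eqI) (simp add: matrix_entry_def)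
    then have "B (\<Sum>i\<in>F. ell2_scale (ell2_nth f i) (ell2_basis i)) = C (\<Sum>i\<in>F. ell2_scale (ell2_nth f i) (ell2_basis i))"
      using B C by (simp add: linear_sum[OF bounded_linear.linear[OF lin(1)]]
        linear_sum[OF bounded_linear.linear[OF lin(2)]] bounded_op_def)
    then show "\<exists>g\<in>?Z. dist g f < e" using F(2) by (auto simp: dist_norm)
  qed
  ultimately show "B f = C f" by (simp add: closure_closed)
qed

lemma schur_map_eqI:
  assumes "schur_product_op \<phi> A B"
  shows "schur_map \<phi> A = B"
  unfolding schur_map_def
proof (rule the_equality)
  show "schur_product_op \<phi> A B" by (rule assms)
  show "C = B" if "schur_product_op \<phi> A C" for C
    using that assms by (intro bounded_op_eqI) (auto simp: schur_product_op_def)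
qed

definition finite_matrix_op :: "'i set \<Rightarrow> ('i \<Rightarrow> 'i \<Rightarrow> real) \<Rightarrow> 'i ell2 \<Rightarrow> 'i ell2"
  where "finite_matrix_op X A f =
    (\<Sum>x\<in>X. ell2_scale (\<Sum>y\<in>X. of_real (A x y) * ell2_nth f y) (ell2_basis x))"

lemma finite_matrix_op_nth:
  "finite X \<Longrightarrow> ell2_nth (finite_matrix_op X A f) x =
    (if x \<in> X then \<Sum>y\<in>X. of_real (A x y) * ell2_nth f y else 0)"
  by (simp add: finite_matrix_op_def ell2_nth_sum if_distrib[of "(*) _"] sum.delta' cong: if_cong)

lemma norm_finite_matrix_op:
  assumes X: "finite X" and A: "contractive_matrix X A"
  shows "norm (finite_matrix_op X A f) \<le> norm f"
proof -
  define c where "c x = (\<Sum>y\<in>X. of_real (A x y) * ell2_nth f y)" for x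
  \<comment> \<open>A real matrix acts separately on real and imaginary parts.\<close>
  have part: "(\<Sum>x\<in>X. (\<Sum>y\<in>X. A x y * t y)\<^sup>2) \<le> (\<Sum>y\<in>X. (t y)\<^sup>2)" for t
  proof -
    \<comment> \<open>The bilinear form is tested on the pair \<open>A t\<close>, \<open>t\<close>.\<close>
    have "2 * (\<Sum>x\<in>X. \<Sum>y\<in>X. A x y * (\<Sum>y\<in>X. A x y * t y) * t y) \<le>
        (\<Sum>x\<in>X. (\<Sum>y\<in>X. A x y * t y)\<^sup>2) + (\<Sum>x\<in>X. (t x)\<^sup>2)"
      using A unfolding contractive_matrix_def by (rule allE) (erule allE)
    also have "(\<Sum>x\<in>X. \<Sum>y\<in>X. A x y * (\<Sum>y\<in>X. A x y * t y) * t y) = (\<Sum>x\<in>X. (\<Sum>y\<in>X. A x y * t y)\<^sup>2)"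
      by (intro sum.cong refl) (simp add: power2_eq_square sum_distrib_left mult_ac)
    finally show ?thesis by simp
  qed
  have "(norm (finite_matrix_op X A f))\<^sup>2 = (\<Sum>x\<in>X. (cmod (c x))\<^sup>2)"
    by (subst norm_ell2_finite_support[OF X])
      (auto simp: finite_matrix_op_nth[OF X] c_def intro!: sum.cong)
  also have "\<dots> = (\<Sum>x\<in>X. (\<Sum>y\<in>X. A x y * Re (ell2_nth f y))\<^sup>2) + (\<Sum>x\<in>X. (\<Sum>y\<in>X. A x y * Im (ell2_nth f y))\<^sup>2)"
    by (simp add: cmod_power2 sum.distrib c_def)
  also have "\<dots> \<le> (\<Sum>y\<in>X. (Re (ell2_nth f y))\<^sup>2) + (\<Sum>y\<in>X. (Im (ell2_nth f y))\<^sup>2)"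
    by (intro add_mono part)
  also have "\<dots> = (\<Sum>y\<in>X. (cmod (ell2_nth f y))\<^sup>2)"
    by (simp add: cmod_power2 sum.distrib)
  also have "\<dots> \<le> (norm f)\<^sup>2" by (rule finite_sum_le_norm_ell2[OF X])
  finally show ?thesis by (rule power2_le_imp_le) simp
qed

lemma bounded_op_finite_matrix_op:
  assumes X: "finite X" and A: "contractive_matrix X A"
  shows "bounded_op (finite_matrix_op X A)" "onorm (finite_matrix_op X A) \<le> 1"
proof -
  have "bounded_linear (finite_matrix_op X A)"
  proof (rule bounded_linear_intro[where K = 1])
    show "finite_matrix_op X A (f + g) = finite_matrix_op X A f + finite_matrix_op X A g" for f g
      by (rule ell2_eqI) (simp add: finite_matrix_op_nth[OF X] sum.distrib algebra_simps)
    show "finite_matrix_op X A (r *\<^sub>R f) = r *\<^sub>R finite_matrix_op X A f" for r f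
      by (rule ell2_eqI) (simp add: finite_matrix_op_nth[OF X] scaleR_sum_right)
  qed (simp add: norm_finite_matrix_op[OF X A])
  moreover have "finite_matrix_op X A (ell2_scale c f) = ell2_scale c (finite_matrix_op X A f)" for c f
    by (rule ell2_eqI) (simp add: finite_matrix_op_nth[OF X] sum_distrib_left mult_ac)
  ultimately show "bounded_op (finite_matrix_op X A)" by (simp add: bounded_op_def)
  show "onorm (finite_matrix_op X A) \<le> 1"
    by (rule onorm_bound) (simp_all add: norm_finite_matrix_op[OF X A])
qed

text \<open>All that is used of the norm bound is its effect on real matrices supported on a finite square. For
these it bounds the bilinear form of the Schur product on real vectors, of which the real part is
taken.\<close>

theorem schur_contraction_real_part:
  assumes \<phi>: "schur_multiplier \<phi>" "schur_norm \<phi> \<le> 1"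
    and X: "finite X" and A: "contractive_matrix X A"
  shows "contractive_matrix X (\<lambda>x y. Re (\<phi> (x, y)) * A x y)"
  unfolding contractive_matrix_def
proof (intro allI)
  fix s t :: "'a \<Rightarrow> real"
  note op = bounded_op_finite_matrix_op[OF X A]
  obtain B where B: "schur_product_op \<phi> (finite_matrix_op X A) B"
    using \<phi>(1) op(1) unfolding schur_multiplier_def by blast
  have "ennreal (onorm (schur_map \<phi> (finite_matrix_op X A))) \<le> schur_norm \<phi>"
    unfolding schur_norm_def by (rule SUP_upper) (use op in simp)
  also note \<phi>(2)
  finally have "ennreal (onorm B) \<le> 1" by (simp only: schur_map_eqI[OF B])
  then have onB: "onorm B \<le> 1" by (simp add: ennreal_le_1)
  have linB: "bounded_linear B" and matB: "matrix_entry B x y = \<phi> (x, y) * matrix_entry (finite_matrix_op X A) x y" for x y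
    using B by (auto simp: schur_product_op_def bounded_op_def)
  have entry: "matrix_entry (finite_matrix_op X A) x y = of_real (A x y)" if "x \<in> X" "y \<in> X" for x y
    using that X by (simp add: matrix_entry_def finite_matrix_op_nth[OF X] if_distrib[of "(*) _"] sum.delta cong: if_cong)
  define vec where "vec s = (\<Sum>x\<in>X. s x *\<^sub>R ell2_basis x)" for s :: "'a \<Rightarrow> real"
  have norm_vec: "(norm (vec s))\<^sup>2 = (\<Sum>x\<in>X. (s x)\<^sup>2)" for s
  proof -
    have nth: "ell2_nth (vec s) x = (if x \<in> X then of_real (s x) else 0)" for x
      using X by (simp add: vec_def ell2_nth_sum scaleR_conv_of_real if_distrib[of "(*) _"] sum.delta' cong: if_cong)
    show ?thesis by (subst norm_ell2_finite_support[OF X]) (auto simp: nth)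
  qed
  have "(\<Sum>x\<in>X. \<Sum>y\<in>X. Re (\<phi> (x, y)) * A x y * s x * t y) = inner (B (vec t)) (vec s)"
  proof -
    have "inner (B (vec t)) (vec s) = (\<Sum>x\<in>X. s x * Re (ell2_nth (B (vec t)) x))"
      by (simp add: vec_def inner_sum_right inner_ell2_basis)
    also have "\<dots> = (\<Sum>x\<in>X. s x * (\<Sum>y\<in>X. t y * Re (matrix_entry B x y)))"
      unfolding vec_def matrix_entry_def linear_sum[OF bounded_linear.linear[OF linB]]
        linear_scale[OF bounded_linear.linear[OF linB]]
      by (simp add: ell2_nth_sum)
    also have "\<dots> = (\<Sum>x\<in>X. \<Sum>y\<in>X. Re (\<phi> (x, y)) * A x y * s x * t y)"
      by (simp add: matB entry sum_distrib_left mult_ac)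
    finally show ?thesis by simp
  qed
  also have "\<dots> \<le> norm (B (vec t)) * norm (vec s)" by (rule norm_cauchy_schwarz)
  also have "\<dots> \<le> norm (vec t) * norm (vec s)"
  proof (intro mult_right_mono)
    have "norm (B (vec t)) \<le> onorm B * norm (vec t)" by (rule onorm[OF linB])
    also have "\<dots> \<le> 1 * norm (vec t)" by (intro mult_right_mono onB) simp
    finally show "norm (B (vec t)) \<le> norm (vec t)" by simp
  qed simp
  finally have "2 * (\<Sum>x\<in>X. \<Sum>y\<in>X. Re (\<phi> (x, y)) * A x y * s x * t y) \<le> 2 * norm (vec t) * norm (vec s)"
    by simp
  also have "\<dots> \<le> (norm (vec t))\<^sup>2 + (norm (vec s))\<^sup>2" by (rule sum_squares_bound)
  finally show "2 * (\<Sum>x\<in>X. \<Sum>y\<in>X. Re (\<phi> (x, y)) * A x y * s x * t y) \<le> (\<Sum>x\<in>X. (s x)\<^sup>2) + (\<Sum>x\<in>X. (t x)\<^sup>2)"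
    by (simp add: norm_vec)
qed

lemma ell2_from_finite_bound:
  assumes "\<And>X. finite X \<Longrightarrow> (\<Sum>x\<in>X. (cmod (b x))\<^sup>2) \<le> M\<^sup>2" "0 \<le> M"
  shows "ell2_nth (Abs_ell2 b) = b" "norm (Abs_ell2 b) \<le> M"
proof -
  have "(\<lambda>x. (cmod (b x))\<^sup>2) summable_on UNIV"
    by (rule nonneg_bdd_above_summable_on) (use assms(1) in \<open>auto intro!: bdd_aboveI2[where M = "M\<^sup>2"]\<close>)
  then show nth: "ell2_nth (Abs_ell2 b) = b" by (simp add: Abs_ell2_inverse)
  have "(norm (Abs_ell2 b))\<^sup>2 \<le> M\<^sup>2"
    by (rule has_sum_le_finite_sums[OF has_sum_norm_ell2]) (simp add: nth assms(1))
  then show "norm (Abs_ell2 b) \<le> M" by (rule power2_le_imp_le[OF _ assms(2)])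
qed

text \<open>With \<open>k x y = (\<Sum>i. r x i * r y i)\<close>, the Schur product is \<open>B = (\<Sum>i. D i \<circ> A \<circ> D i)\<close>, defined
coordinatewise. By the Cauchy-Schwarz inequality in \<open>i\<close> and \<open>\<Sum>i. (r x i)\<^sup>2 \<le> 1\<close>,
\<open>(norm (B f))\<^sup>2 \<le> (\<Sum>i. (norm (A (D i f)))\<^sup>2) \<le> (onorm A)\<^sup>2 * (\<Sum>i. (norm (D i f))\<^sup>2)\<close>, and the last sum
is at most \<open>(norm f)\<^sup>2\<close>.\<close>

theorem schur_contraction_of_pos_def_kernel:
  fixes k :: "'i \<Rightarrow> 'i \<Rightarrow> real"
  assumes k: "pos_def_kernel k" and diag: "\<And>x. k x x \<le> 1"
  shows "schur_multiplier (\<lambda>(x, y). complex_of_real (k x y))"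
    and "schur_norm (\<lambda>(x, y). complex_of_real (k x y)) \<le> 1"
proof -
  obtain v :: "'i \<Rightarrow> 'i ell2" where v: "\<And>x y. inner (v x) (v y) = k x y"
      "\<And>x i. Im (ell2_nth (v x) i) = 0"
    using kolmogorov_decomposition[OF k inj_on_id] by blast
  define r where "r x i = Re (ell2_nth (v x) i)" for x i
  have r_sum: "((\<lambda>i. r x i * r y i) has_sum k x y) UNIV" for x y
    using has_sum_inner_ell2[of "v x" "v y"] by (simp add: v r_def inner_complex_def)
  have r_le: "(\<Sum>i\<in>I. (r x i)\<^sup>2) \<le> 1" if "finite I" for I x
  proof -
    have "(\<Sum>i\<in>I. (r x i)\<^sup>2) \<le> k x x"
      using finite_sum_le_has_sum[OF r_sum that, of x x] by (simp add: power2_eq_square)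
    with diag[of x] show ?thesis by linarith
  qed
  define D where "D i f = Abs_ell2 (\<lambda>x. of_real (r x i) * ell2_nth f x)" for i f
  have D: "ell2_nth (D i f) = (\<lambda>x. of_real (r x i) * ell2_nth f x)" for i f
    unfolding D_def
  proof (rule ell2_from_finite_bound)
    fix X :: "'i set" assume X: "finite X"
    have "(\<Sum>x\<in>X. (cmod (of_real (r x i) * ell2_nth f x))\<^sup>2) = (\<Sum>x\<in>X. (r x i)\<^sup>2 * (cmod (ell2_nth f x))\<^sup>2)"
      by (simp add: norm_mult power_mult_distrib)
    also have "\<dots> \<le> (\<Sum>x\<in>X. 1 * (cmod (ell2_nth f x))\<^sup>2)"
      using r_le[of "{i}"] by (intro sum_mono mult_right_mono) auto
    also have "\<dots> \<le> (norm f)\<^sup>2" using finite_sum_le_norm_ell2[OF X] by simp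
    finally show "(\<Sum>x\<in>X. (cmod (of_real (r x i) * ell2_nth f x))\<^sup>2) \<le> (norm f)\<^sup>2" .
  qed simp
  have D_le: "(\<Sum>i\<in>I. (norm (D i f))\<^sup>2) \<le> (norm f)\<^sup>2" if I: "finite I" for I f
  proof (rule has_sum_mono)
    show "((\<lambda>x. \<Sum>i\<in>I. (cmod (ell2_nth (D i f) x))\<^sup>2) has_sum (\<Sum>i\<in>I. (norm (D i f))\<^sup>2)) UNIV"
      by (intro has_sum_finite_sum has_sum_norm_ell2)
    show "((\<lambda>x. (cmod (ell2_nth f x))\<^sup>2) has_sum (norm f)\<^sup>2) UNIV" by (rule has_sum_norm_ell2)
    show "(\<Sum>i\<in>I. (cmod (ell2_nth (D i f) x))\<^sup>2) \<le> (cmod (ell2_nth f x))\<^sup>2" for x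
    proof -
      have "(\<Sum>i\<in>I. (cmod (ell2_nth (D i f) x))\<^sup>2) = (\<Sum>i\<in>I. (r x i)\<^sup>2) * (cmod (ell2_nth f x))\<^sup>2"
        by (simp add: D norm_mult power_mult_distrib sum_distrib_right)
      also have "\<dots> \<le> 1 * (cmod (ell2_nth f x))\<^sup>2"
        by (intro mult_right_mono r_le I) simp
      finally show ?thesis by simp
    qed
  qed
  have main: "\<exists>B. schur_product_op (\<lambda>(x, y). complex_of_real (k x y)) A B \<and> onorm B \<le> onorm A"
    if A: "bounded_op A" for A
  proof -
    have linA: "bounded_linear A" and scaleA: "A (ell2_scale c f) = ell2_scale c (A f)" for c f
      using A by (auto simp: bounded_op_def)
    define N where "N = onorm A"
    have N0: "0 \<le> N" unfolding N_def by (rule onorm_pos_le[OF linA])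
    have AD_le: "(\<Sum>i\<in>I. (norm (A (D i f)))\<^sup>2) \<le> (N * norm f)\<^sup>2" if I: "finite I" for I f
    proof -
      have "(\<Sum>i\<in>I. (norm (A (D i f)))\<^sup>2) \<le> (\<Sum>i\<in>I. N\<^sup>2 * (norm (D i f))\<^sup>2)"
        using onorm[OF linA] unfolding N_def power_mult_distrib[symmetric]
        by (intro sum_mono power_mono) auto
      also have "\<dots> = N\<^sup>2 * (\<Sum>i\<in>I. (norm (D i f))\<^sup>2)" by (simp add: sum_distrib_left)
      also have "\<dots> \<le> N\<^sup>2 * (norm f)\<^sup>2" by (intro mult_left_mono D_le I) simp
      finally show ?thesis by (simp add: power_mult_distrib)
    qed
    define T where "T f x i = of_real (r x i) * ell2_nth (A (D i f)) x" for f x i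
    have T_sum: "T f x summable_on UNIV" for f x
    proof (rule abs_summable_summable, rule summable_on_comparison_test)
      have "(\<lambda>i. (norm (A (D i f)))\<^sup>2) summable_on UNIV"
        by (rule nonneg_bdd_above_summable_on)
          (use AD_le in \<open>auto intro!: bdd_aboveI2[where M = "(N * norm f)\<^sup>2"]\<close>)
      moreover have "(\<lambda>i. (r x i)\<^sup>2) summable_on UNIV"
        using has_sum_imp_summable[OF r_sum[of x x]] by (simp add: power2_eq_square)
      ultimately show "(\<lambda>i. (r x i)\<^sup>2 + (norm (A (D i f)))\<^sup>2) summable_on UNIV"
        by (intro summable_on_add)
      fix i
      have "norm (T f x i) \<le> \<bar>r x i\<bar> * norm (A (D i f))"
        by (simp add: T_def norm_mult mult_left_mono cmod_le_norm_ell2)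
      also have "\<dots> \<le> 2 * \<bar>r x i\<bar> * norm (A (D i f))" by simp
      also have "\<dots> \<le> (r x i)\<^sup>2 + (norm (A (D i f)))\<^sup>2"
        using sum_squares_bound[of "\<bar>r x i\<bar>" "norm (A (D i f))"] by simp
      finally show "norm (T f x i) \<le> (r x i)\<^sup>2 + (norm (A (D i f)))\<^sup>2" .
    qed simp
    define b where "b f x = infsum (T f x) UNIV" for f x
    define B where "B f = Abs_ell2 (b f)" for f
    have b_le: "(\<Sum>x\<in>X. (cmod (b f x))\<^sup>2) \<le> (N * norm f)\<^sup>2" if X: "finite X" for X f
    proof (rule tendsto_upperbound)
      show "((\<lambda>I. \<Sum>x\<in>X. (cmod (\<Sum>i\<in>I. T f x i))\<^sup>2) \<longlongrightarrow> (\<Sum>x\<in>X. (cmod (b f x))\<^sup>2)) (finite_subsets_at_top UNIV)"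
        unfolding b_def by (intro tendsto_intros infsum_tendsto T_sum)
      have "(\<Sum>x\<in>X. (cmod (\<Sum>i\<in>I. T f x i))\<^sup>2) \<le> (N * norm f)\<^sup>2" if I: "finite I" for I
      proof -
        have "(cmod (\<Sum>i\<in>I. T f x i))\<^sup>2 \<le> (\<Sum>i\<in>I. (cmod (ell2_nth (A (D i f)) x))\<^sup>2)" for x
        proof -
          have "(cmod (\<Sum>i\<in>I. T f x i))\<^sup>2 \<le> (\<Sum>i\<in>I. \<bar>r x i\<bar> * cmod (ell2_nth (A (D i f)) x))\<^sup>2"
            by (intro power_mono order_trans[OF norm_sum]) (simp_all add: T_def norm_mult)
          also have "\<dots> \<le> (\<Sum>i\<in>I. \<bar>r x i\<bar>\<^sup>2) * (\<Sum>i\<in>I. (cmod (ell2_nth (A (D i f)) x))\<^sup>2)"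
            by (rule Cauchy_Schwarz_ineq_sum)
          also have "\<dots> \<le> 1 * (\<Sum>i\<in>I. (cmod (ell2_nth (A (D i f)) x))\<^sup>2)"
            using r_le[OF I] by (intro mult_right_mono sum_nonneg) auto
          finally show ?thesis by simp
        qed
        then have "(\<Sum>x\<in>X. (cmod (\<Sum>i\<in>I. T f x i))\<^sup>2) \<le> (\<Sum>x\<in>X. \<Sum>i\<in>I. (cmod (ell2_nth (A (D i f)) x))\<^sup>2)"
          by (intro sum_mono)
        also have "\<dots> = (\<Sum>i\<in>I. \<Sum>x\<in>X. (cmod (ell2_nth (A (D i f)) x))\<^sup>2)" by (rule sum.swap)
        also have "\<dots> \<le> (\<Sum>i\<in>I. (norm (A (D i f)))\<^sup>2)"
          by (intro sum_mono finite_sum_le_norm_ell2 X)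
        also have "\<dots> \<le> (N * norm f)\<^sup>2" by (rule AD_le[OF I])
        finally show ?thesis .
      qed
      then show "\<forall>\<^sub>F I in finite_subsets_at_top UNIV. (\<Sum>x\<in>X. (cmod (\<Sum>i\<in>I. T f x i))\<^sup>2) \<le> (N * norm f)\<^sup>2"
        by (auto intro: eventually_finite_subsets_at_top_weakI)
    qed simp
    have B: "ell2_nth (B f) = b f" "norm (B f) \<le> N * norm f" for f
      unfolding B_def using b_le[of _ f] N0 by (auto intro!: ell2_from_finite_bound[of "b f" "N * norm f"])
    have D_add: "D i (f + g) = D i f + D i g" and D_scaleR: "D i (c *\<^sub>R f) = c *\<^sub>R D i f"
      and D_scale: "D i (ell2_scale d f) = ell2_scale d (D i f)"
      and D_basis: "D i (ell2_basis y) = r y i *\<^sub>R ell2_basis y" for i f g c d y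
      by (rule ell2_eqI; simp add: D algebra_simps scaleR_conv_of_real)+
    have linB: "bounded_linear B"
    proof (rule bounded_linear_intro[where K = N])
      show "B (f + g) = B f + B g" for f g
      proof (rule ell2_eqI)
        fix x
        have "T (f + g) x = (\<lambda>i. T f x i + T g x i)"
          by (auto simp: T_def D_add linear_add[OF bounded_linear.linear[OF linA]] algebra_simps)
        then show "ell2_nth (B (f + g)) x = ell2_nth (B f + B g) x"
          by (simp add: B b_def infsum_add T_sum)
      qed
      show "B (c *\<^sub>R f) = c *\<^sub>R B f" for c f
      proof (rule ell2_eqI)
        fix x
        have "T (c *\<^sub>R f) x = (\<lambda>i. of_real c * T f x i)"
          by (auto simp: T_def D_scaleR linear_scale[OF bounded_linear.linear[OF linA]] scaleR_conv_of_real)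
        then show "ell2_nth (B (c *\<^sub>R f)) x = ell2_nth (c *\<^sub>R B f) x"
          by (simp add: B b_def infsum_cmult_right' scaleR_conv_of_real)
      qed
      show "norm (B f) \<le> norm f * N" for f using B(2)[of f] by (simp add: mult.commute)
    qed
    have "B (ell2_scale c f) = ell2_scale c (B f)" for c f
    proof (rule ell2_eqI)
      fix x
      have "T (ell2_scale c f) x = (\<lambda>i. c * T f x i)"
        by (auto simp: T_def D_scale scaleA)
      then show "ell2_nth (B (ell2_scale c f)) x = ell2_nth (ell2_scale c (B f)) x"
        by (simp add: B b_def infsum_cmult_right')
    qed
    with linB have "bounded_op B" by (simp add: bounded_op_def)
    moreover have "matrix_entry B x y = of_real (k x y) * matrix_entry A x y" for x y
    proof -
      have "(T (ell2_basis y) x has_sum (of_real (k x y) * matrix_entry A x y)) UNIV"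
      proof -
        have "T (ell2_basis y) x = (\<lambda>i. of_real (r x i * r y i) * matrix_entry A x y)"
          by (auto simp: T_def D_basis linear_scale[OF bounded_linear.linear[OF linA]]
            matrix_entry_def scaleR_conv_of_real)
        then show ?thesis
          by (simp only:) (intro has_sum_cmult_left has_sum_of_real r_sum)
      qed
      then show ?thesis by (simp add: matrix_entry_def B b_def infsumI)
    qed
    moreover have "onorm B \<le> onorm A"
      using B(2) N0 unfolding N_def by (intro onorm_bound) auto
    ultimately show ?thesis by (auto simp: schur_product_op_def)
  qed
  then show "schur_multiplier (\<lambda>(x, y). complex_of_real (k x y))"
    unfolding schur_multiplier_def by blast
  show "schur_norm (\<lambda>(x, y). complex_of_real (k x y)) \<le> 1"
    unfolding schur_norm_def
  proof (rule SUP_least, clarify)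
    fix A :: "'i ell2 \<Rightarrow> 'i ell2" assume "bounded_op A" "onorm A \<le> 1"
    then obtain B where "schur_product_op (\<lambda>(x, y). complex_of_real (k x y)) A B" "onorm B \<le> 1"
      using main by force
    then show "ennreal (onorm (schur_map (\<lambda>(x, y). complex_of_real (k x y)) A)) \<le> 1"
      by (simp add: schur_map_eqI ennreal_le_1)
  qed
qed

section \<open>Translates, tubes and continuous coarse embeddings\<close>

lemma mem_Tube [simp]: "(x, y) \<in> Tube K \<longleftrightarrow> - x + y \<in> K"
  by (simp add: Tube_def)

lemma open_left_translate:
  fixes W :: "'a::topological_group_add set"
  assumes "open W"
  shows "open {y. - g + y \<in> W}"
  using open_vimage[OF assms, of "\<lambda>y. - g + y"] by (simp add: vimage_def continuous_on_add)

lemma compact_left_translate: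
  fixes V :: "'a::topological_group_add set"
  assumes "compact V"
  shows "compact ((\<lambda>y. g + y) ` V)"
  by (intro compact_continuous_image continuous_intros assms)

lemma sigma_compact_countable_translates:
  fixes W :: "'a::topological_group_add set"
  assumes "sigma_compact (UNIV :: 'a set)" "open W" "0 \<in> W"
  obtains g :: "nat \<Rightarrow> 'a" where "\<And>x. \<exists>n. - g n + x \<in> W"
proof -
  obtain C :: "nat \<Rightarrow> 'a set" where C: "\<And>n. compact (C n)" "UNIV = (\<Union>n. C n)"
    using assms(1) by (auto simp: sigma_compact_def)
  have "\<exists>S. finite S \<and> C n \<subseteq> (\<Union>c\<in>S. {y. - c + y \<in> W})" for n
  proof (rule compactE_image[OF C(1)[of n]])
    show "open {y. - c + y \<in> W}" for c by (rule open_left_translate[OF assms(2)])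
    show "C n \<subseteq> (\<Union>c\<in>UNIV. {y. - c + y \<in> W})"
    proof
      fix x
      have "- x + x \<in> W" using assms(3) by simp
      then show "x \<in> (\<Union>c\<in>UNIV. {y. - c + y \<in> W})" by blast
    qed
  qed auto
  then obtain S where S: "\<And>n. finite (S n)" "\<And>n. C n \<subseteq> (\<Union>c\<in>S n. {y. - c + y \<in> W})" by metis
  have cover: "\<exists>c\<in>(\<Union>n. S n). - c + x \<in> W" for x
  proof -
    obtain n where "x \<in> C n" using C(2) by blast
    then show ?thesis using S(2)[of n] by blast
  qed
  have "(\<Union>n. S n) \<noteq> {}" using cover by blast
  moreover have "countable (\<Union>n. S n)" using S(1) by (auto intro: countable_finite)
  ultimately have range: "range (from_nat_into (\<Union>n. S n)) = (\<Union>n. S n)" by (rule range_from_nat_into)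
  have "\<exists>n. - from_nat_into (\<Union>n. S n) n + x \<in> W" for x
  proof -
    obtain c where c: "c \<in> (\<Union>n. S n)" "- c + x \<in> W" using cover by blast
    then obtain n where "c = from_nat_into (\<Union>n. S n) n" by (metis range imageE)
    with c(2) show ?thesis by blast
  qed
  then show ?thesis by (rule that)
qed

lemma compact_neighbourhood_of_zero:
  assumes "locally_compact_space (euclidean :: 'a::topological_group_add topology)"
  obtains U V :: "'a::topological_group_add set" where "open U" "compact V" "0 \<in> U" "U \<subseteq> V"
proof -
  have "\<exists>U V. openin euclidean U \<and> compactin euclidean V \<and> (0 :: 'a) \<in> U \<and> U \<subseteq> V"
    using assms by (simp add: locally_compact_space_def)
  then show ?thesis using that by (auto simp: compactin_euclidean_iff)
qed

text \<open>Finite unions of translates of a compact neighbourhood \<open>V\<close> of \<open>0\<close>: since the translates of its interior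
cover the group, every compact set is contained in one of these unions.\<close>

lemma compact_exhaustion:
  assumes "locally_compact_space (euclidean :: 'a::topological_group_add topology)"
    and "sigma_compact (UNIV :: 'a set)"
  shows "\<exists>K :: nat \<Rightarrow> 'a set. (\<forall>n. compact (K n)) \<and> (\<forall>n. 0 \<in> K n) \<and>
    (\<forall>m n. m \<le> n \<longrightarrow> K m \<subseteq> K n) \<and> (\<forall>D. compact D \<longrightarrow> (\<exists>n. D \<subseteq> K n))"
proof -
  obtain U V :: "'a set" where UV: "open U" "compact V" "0 \<in> U" "U \<subseteq> V"
    by (rule compact_neighbourhood_of_zero[OF assms(1)])
  obtain g :: "nat \<Rightarrow> 'a" where g: "\<And>x. \<exists>n. - g n + x \<in> U"
    using sigma_compact_countable_translates[OF assms(2) UV(1,3)] by blast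
  define K where "K n = insert 0 (\<Union>i\<le>n. (\<lambda>y. g i + y) ` V)" for n
  show ?thesis
  proof (intro exI[of _ K] conjI allI impI)
    show "compact (K n)" for n
      unfolding K_def by (intro compact_insert compact_UN finite_atMost compact_left_translate UV)
    show "0 \<in> K n" for n by (simp add: K_def)
    show "K m \<subseteq> K n" if "m \<le> n" for m n using that by (force simp: K_def)
    show "\<exists>n. D \<subseteq> K n" if D: "compact D" for D
    proof (rule compactE_image[OF D])
      show "open {y. - g i + y \<in> U}" for i by (rule open_left_translate[OF UV(1)])
      show "D \<subseteq> (\<Union>i. {y. - g i + y \<in> U})" using g by blast
      fix I assume I: "finite I" "D \<subseteq> (\<Union>i\<in>I. {y. - g i + y \<in> U})"
      have "D \<subseteq> K (Max I)"
      proof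
        fix y assume "y \<in> D"
        then obtain i where i: "i \<in> I" "- g i + y \<in> U" using I(2) by blast
        then have "y = g i + (- g i + y)" "- g i + y \<in> V" using UV(4) by (auto simp flip: add.assoc)
        then have "y \<in> (\<lambda>y. g i + y) ` V" by blast
        then show "y \<in> K (Max I)" using i(1) I(1) by (auto simp: K_def)
      qed
      then show "\<exists>n. D \<subseteq> K n" by blast
    qed
  qed
qed

lemma continuous_bump:
  assumes lc: "locally_compact_space (euclidean :: 'a::t2_space topology)"
    and U: "open U" "x \<in> U"
  shows "\<exists>f :: 'a \<Rightarrow> real. continuous_on UNIV f \<and> (\<forall>y. 0 \<le> f y \<and> f y \<le> 1) \<and> f x = 1 \<and> (\<forall>y. y \<notin> U \<longrightarrow> f y = 0)"
proof -
  have "Hausdorff_space (euclidean :: 'a topology)"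
    by (simp add: Hausdorff_space_def disjnt_def) (metis hausdorff)
  then have "completely_regular_space (euclidean :: 'a topology)"
    using locally_compact_regular_imp_completely_regular_space[OF lc] by blast
  moreover have "closedin euclidean (- U)" "x \<in> topspace euclidean - (- U)"
    using U by (auto simp: closed_closedin[symmetric])
  ultimately obtain h :: "'a \<Rightarrow> real" where h: "continuous_map euclidean (top_of_set {0..1}) h"
      "h x = 0" "h ` (- U) \<subseteq> {1}"
    unfolding completely_regular_space_def by blast
  have "continuous_on UNIV h" "\<And>y. h y \<in> {0..1}"
    using h(1) by (auto simp: continuous_map_in_subtopology)
  then show ?thesis
    using h(2,3) by (intro exI[of _ "\<lambda>y. 1 - h y"]) (auto intro!: continuous_intros)
qed

lemma coarse_embedding_bound:
  assumes "coarse_embedding u" "compact K"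
  shows "\<exists>R>0. \<forall>s t. - s + t \<in> K \<longrightarrow> norm (u s - u t) \<le> R"
  using assms by (simp add: coarse_embedding_def)

lemma coarse_embedding_proper:
  assumes "coarse_embedding u" "0 < R"
  shows "\<exists>K. compact K \<and> (\<forall>s t. norm (u s - u t) \<le> R \<longrightarrow> - s + t \<in> K)"
  using assms by (simp add: coarse_embedding_def)

lemma coarse_embedding_bounded_perturbation:
  assumes u: "coarse_embedding u" and R: "\<And>x. norm (w x - u x) \<le> R"
  shows "coarse_embedding w"
proof -
  have R0: "0 \<le> R" using order_trans[OF norm_ge_zero R] .
  have close: "\<bar>norm (w s - w t) - norm (u s - u t)\<bar> \<le> 2 * R" for s t
  proof -
    have "\<bar>norm (w s - w t) - norm (u s - u t)\<bar> \<le> norm ((w s - w t) - (u s - u t))"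
      by (rule norm_triangle_ineq3)
    also have "\<dots> = norm ((w s - u s) - (w t - u t))" by (simp add: algebra_simps)
    also have "\<dots> \<le> norm (w s - u s) + norm (w t - u t)" by (rule norm_triangle_ineq4)
    finally show ?thesis using R[of s] R[of t] by linarith
  qed
  show ?thesis
    unfolding coarse_embedding_def
  proof (intro conjI allI impI)
    fix K :: "'a set" assume "compact K"
    then obtain r where r: "r > 0" "\<And>s t. - s + t \<in> K \<Longrightarrow> norm (u s - u t) \<le> r"
      using coarse_embedding_bound[OF u] by blast
    have "norm (w s - w t) \<le> r + 2 * R" if "- s + t \<in> K" for s t
      using r(2)[OF that] close[of s t] by linarith
    then show "\<exists>R>0. \<forall>s t. (s, t) \<in> Tube K \<longrightarrow> norm (w s - w t) \<le> R"
      using r(1) R0 by (intro exI[of _ "r + 2 * R"]) auto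
  next
    fix r :: real assume "0 < r"
    then have "0 < r + 2 * R" using R0 by simp
    then obtain K where K: "compact K" "\<And>s t. norm (u s - u t) \<le> r + 2 * R \<Longrightarrow> - s + t \<in> K"
      using coarse_embedding_proper[OF u] by blast
    have "- s + t \<in> K" if "norm (w s - w t) \<le> r" for s t
      using that close[of s t] by (intro K(2)) linarith
    with K(1) show "\<exists>K. compact K \<and> (\<forall>s t. norm (w s - w t) \<le> r \<longrightarrow> (s, t) \<in> Tube K)" by auto
  qed
qed

text \<open>Continuity is a local property, so the Weierstrass test is needed only near each point.\<close>

lemma continuous_on_suminf_open:
  fixes h :: "nat \<Rightarrow> 'a::t2_space \<Rightarrow> 'b::banach"
  assumes h: "\<And>n. continuous_on UNIV (h n)"
    and bd: "\<And>x. \<exists>N M. open N \<and> x \<in> N \<and> (\<forall>y\<in>N. \<forall>n. norm (h n y) \<le> M * (1/2) ^ n)"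
  shows "continuous_on UNIV (\<lambda>x. \<Sum>n. h n x)"
proof -
  have "isCont (\<lambda>x. \<Sum>n. h n x) x" for x
  proof -
    obtain N M where N: "open N" "x \<in> N" "\<And>y n. y \<in> N \<Longrightarrow> norm (h n y) \<le> M * (1/2) ^ n"
      using bd by meson
    have "summable (\<lambda>n. M * (1/2) ^ n :: real)" by (intro summable_mult summable_geometric) simp
    then have "uniform_limit N (\<lambda>n y. \<Sum>i<n. h i y) (\<lambda>y. \<Sum>i. h i y) sequentially"
      by (intro Weierstrass_m_test[of _ _ "\<lambda>n. M * (1/2) ^ n"] N(3))
    then have "continuous_on N (\<lambda>x. \<Sum>n. h n x)"
      by (rule uniform_limit_theorem[rotated])
        (auto intro!: always_eventually continuous_on_sum continuous_on_subset[OF h])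
    then show ?thesis using N(1,2) continuous_on_eq_continuous_at by blast
  qed
  then show ?thesis by (simp add: continuous_at_imp_continuous_on)
qed

text \<open>The new embedding is the average of the values \<open>u (g n)\<close> with the continuous weights \<open>p n x / S x\<close>, where
\<open>p n x\<close> is nonzero only if \<open>x\<close> belongs to the translate of \<open>V\<close> by \<open>g n\<close>. Hence only values at bounded
distance from \<open>u x\<close> contribute. The factors \<open>(1/2) ^ n\<close> ensure locally uniform convergence without
local finiteness of the cover.\<close>

theorem continuous_coarse_embedding:
  fixes u :: "'a::{topological_group_add, t2_space} \<Rightarrow> 'h::{real_inner, banach}"
  assumes lc: "locally_compact_space (euclidean :: 'a topology)"
    and sc: "sigma_compact (UNIV :: 'a set)" and u: "coarse_embedding u"
  shows "\<exists>w :: 'a \<Rightarrow> 'h. coarse_embedding w \<and> continuous_on UNIV w"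
proof -
  obtain U V :: "'a set" where UV: "open U" "compact V" "0 \<in> U" "U \<subseteq> V"
    by (rule compact_neighbourhood_of_zero[OF lc])
  obtain f :: "'a \<Rightarrow> real" where f: "continuous_on UNIV f" "\<And>y. 0 \<le> f y" "\<And>y. f y \<le> 1" "f 0 = 1"
      "\<And>y. y \<notin> U \<Longrightarrow> f y = 0"
    using continuous_bump[OF lc UV(1,3)] by blast
  have "open {y. 0 < f y}" by (intro open_Collect_less continuous_intros f(1))
  then obtain g :: "nat \<Rightarrow> 'a" where g: "\<And>x. \<exists>n. 0 < f (- g n + x)"
    using sigma_compact_countable_translates[OF sc, of "{y. 0 < f y}"] f(4) by auto
  obtain R where R: "R > 0" "\<And>s t. - s + t \<in> V \<Longrightarrow> norm (u s - u t) \<le> R"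
    using coarse_embedding_bound[OF u UV(2)] by blast
  define p where "p n x = (1/2) ^ n * f (- g n + x)" for n x
  have p0: "0 \<le> p n x" and p_le: "p n x \<le> (1/2) ^ n" for n x
    using f(2,3) by (auto simp: p_def mult_left_le)
  have near: "norm (u (g n) - u x) \<le> R" if "p n x \<noteq> 0" for n x
    using that f(5) UV(4) by (intro R(2)) (auto simp: p_def)
  have cont_p: "continuous_on UNIV (p n)" for n
    unfolding p_def
    by (intro continuous_intros continuous_on_compose2[OF f(1)]) auto
  have geo: "summable (\<lambda>n. (1/2) ^ n :: real)" by (intro summable_geometric) simp
  have sum_p: "summable (\<lambda>n. p n x)" for x
    by (rule summable_comparison_test'[OF geo]) (simp add: p0 p_le)
  define S where "S x = (\<Sum>n. p n x)" for x
  have S0: "0 < S x" for x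
  proof -
    obtain n where "0 < f (- g n + x)" using g by blast
    then have "0 < p n x" by (simp add: p_def)
    then show ?thesis unfolding S_def by (intro suminf_pos2[OF sum_p] p0)
  qed
  have cont_S: "continuous_on UNIV S"
    unfolding S_def
    by (rule continuous_on_suminf_open[OF cont_p]) (use p0 p_le in \<open>auto intro!: exI[of _ UNIV] exI[of _ 1]\<close>)
  have bound: "\<exists>N. open N \<and> x \<in> N \<and> (\<forall>y\<in>N. \<forall>n. norm (p n y *\<^sub>R u (g n)) \<le> (2 * R + norm (u x)) * (1/2) ^ n)" for x
  proof (intro exI conjI ballI allI)
    show "open {y. - x + y \<in> U}" by (rule open_left_translate[OF UV(1)])
    show "x \<in> {y. - x + y \<in> U}" using UV(3) by simp
    fix y n assume "y \<in> {y. - x + y \<in> U}"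
    then have xy: "norm (u x - u y) \<le> R" using UV(4) by (intro R(2)) auto
    show "norm (p n y *\<^sub>R u (g n)) \<le> (2 * R + norm (u x)) * (1/2) ^ n"
    proof (cases "p n y = 0")
      case True
      then show ?thesis using R(1) by simp
    next
      case False
      have "norm (u (g n)) \<le> norm (u (g n) - u y) + norm (u y - u x) + norm (u x)"
        using norm_triangle_ineq[of "u (g n) - u y" "u y - u x"]
          norm_triangle_ineq[of "u (g n) - u x" "u x"] by simp
      then have "norm (u (g n)) \<le> 2 * R + norm (u x)"
        using near[OF False] xy by (simp add: norm_minus_commute)
      then have "p n y * norm (u (g n)) \<le> (1/2) ^ n * (2 * R + norm (u x))"
        by (intro mult_mono p_le) auto
      then show ?thesis by (simp add: p0 mult.commute)
    qed
  qed
  have sum_u: "summable (\<lambda>n. p n x *\<^sub>R u (g n))" for x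
  proof -
    have "summable (\<lambda>n. (2 * R + norm (u x)) * (1/2) ^ n)" by (intro summable_mult geo)
    moreover have "norm (p n x *\<^sub>R u (g n)) \<le> (2 * R + norm (u x)) * (1/2) ^ n" for n
      using bound[of x] by blast
    ultimately show ?thesis by (rule summable_comparison_test')
  qed
  define w where "w x = (1 / S x) *\<^sub>R (\<Sum>n. p n x *\<^sub>R u (g n))" for x
  have "norm (w x - u x) \<le> R" for x
  proof -
    have "S x *\<^sub>R (w x - u x) = (\<Sum>n. p n x *\<^sub>R u (g n)) - (\<Sum>n. p n x *\<^sub>R u x)"
      using S0[of x] suminf_scaleR_left[OF sum_p, of x "u x"] by (simp add: w_def scaleR_diff_right S_def)
    also have "\<dots> = (\<Sum>n. p n x *\<^sub>R (u (g n) - u x))"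
      by (subst suminf_diff[OF sum_u summable_scaleR_left[OF sum_p]]) (simp add: scaleR_diff_right)
    finally have eq: "S x *\<^sub>R (w x - u x) = (\<Sum>n. p n x *\<^sub>R (u (g n) - u x))" .
    have le: "norm (p n x *\<^sub>R (u (g n) - u x)) \<le> p n x * R" for n
      using near[of n x] p0[of n x] by (cases "p n x = 0") (auto intro!: mult_left_mono)
    have "S x * norm (w x - u x) = norm (S x *\<^sub>R (w x - u x))" using S0[of x] by simp
    also have "\<dots> \<le> (\<Sum>n. p n x * R)"
      unfolding eq by (rule norm_suminf_le[OF le summable_mult2[OF sum_p]])
    also have "\<dots> = S x * R" unfolding S_def by (rule suminf_mult2[OF sum_p, symmetric])
    finally show ?thesis using S0[of x] by simp
  qed
  then have "coarse_embedding w" by (rule coarse_embedding_bounded_perturbation[OF u])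
  moreover have "continuous_on UNIV w"
    unfolding w_def
  proof (intro continuous_intros cont_S continuous_on_suminf_open)
    show "\<exists>N M. open N \<and> x \<in> N \<and> (\<forall>y\<in>N. \<forall>n. norm (p n y *\<^sub>R u (g n)) \<le> M * (1/2) ^ n)" for x
      using bound[of x] by blast
  qed (use less_imp_neq[OF S0] cont_p in auto)
  ultimately show ?thesis by blast
qed

section \<open>Coarse embeddings and Schur multipliers\<close>

instance ell2 :: (type) banach ..

lemma norm_diff_square: "(norm (a - b))\<^sup>2 = inner a a + inner b b - 2 * inner a b"
  for a b :: "'h::real_inner"
  by (simp add: power2_norm_eq_inner inner_diff_left inner_diff_right inner_commute[of b a])

text \<open>Any index set into which \<open>'a\<close> embeds would do; \<open>'a \<times> nat\<close> is the one in \<open>embeds_coarsely\<close>.\<close>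

lemma kernel_distance_realisation:
  fixes k :: "'a \<Rightarrow> 'a \<Rightarrow> real"
  assumes "pos_def_kernel k"
  shows "\<exists>v :: 'a \<Rightarrow> ('a \<times> nat) ell2. \<forall>x y. (norm (v x - v y))\<^sup>2 = k x x + k y y - 2 * k x y"
proof -
  have "inj (\<lambda>x :: 'a. (x, 0 :: nat))" by (rule injI) simp
  then obtain v :: "'a \<Rightarrow> ('a \<times> nat) ell2" where "\<And>x y. inner (v x) (v y) = k x y"
    using kolmogorov_decomposition[OF assms] by metis
  then show ?thesis by (intro exI[of _ v]) (simp add: norm_diff_square)
qed

lemma coarse_embedding_imp_embeds_coarsely:
  fixes u :: "'a::topological_group_add \<Rightarrow> 'h::{real_inner, complete_space}"
  assumes u: "coarse_embedding u"
  shows "embeds_coarsely TYPE('a)"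
proof -
  obtain v :: "'a \<Rightarrow> ('a \<times> nat) ell2" where
    v: "\<And>x y. (norm (v x - v y))\<^sup>2 = inner (u x) (u x) + inner (u y) (u y) - 2 * inner (u x) (u y)"
    using kernel_distance_realisation[OF pos_def_kernel_gram[of u]] by blast
  have "(norm (v x - v y))\<^sup>2 = (norm (u x - u y))\<^sup>2" for x y
    by (simp add: v norm_diff_square[of "u x" "u y"])
  then have "norm (v x - v y) = norm (u x - u y)" for x y
    by (simp add: power2_eq_iff_nonneg)
  then have "coarse_embedding v" using u by (simp add: coarse_embedding_def)
  then show ?thesis unfolding embeds_coarsely_def by blast
qed

theorem schur_approximation_gaussian:
  fixes u :: "'a::topological_group_add \<Rightarrow> 'h::{real_inner, complete_space}"
  assumes u: "coarse_embedding u"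
  shows "schur_approximation (\<lambda>n (x, y). complex_of_real (exp (- (1 / real (Suc n)) * (norm (u x - u y))\<^sup>2)))"
proof -
  define \<psi> where "\<psi> n = (\<lambda>(x, y). complex_of_real (exp (- (1 / real (Suc n)) * (norm (u x - u y))\<^sup>2)))" for n
  have "schur_multiplier (\<psi> n)" "schur_norm (\<psi> n) \<le> 1" for n
    unfolding \<psi>_def
    by (intro schur_contraction_of_pos_def_kernel pos_def_kernel_gaussian; simp)+
  moreover have "tends_to_zero_off_tubes (\<psi> n)" for n
    unfolding tends_to_zero_off_tubes_def
  proof (intro allI impI)
    fix e :: real assume e: "0 < e"
    \<comment> \<open>Chosen such that distances above \<open>r\<close> make the kernel smaller than \<open>e\<close>.\<close>
    define r where "r = sqrt (real (Suc n) * (1 + \<bar>ln e\<bar>))"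
    have r2: "r\<^sup>2 = real (Suc n) * (1 + \<bar>ln e\<bar>)" unfolding r_def by (intro real_sqrt_pow2) simp
    have r0: "0 < r" by (simp add: r_def)
    then obtain K where K: "compact K" "\<And>s t. norm (u s - u t) \<le> r \<Longrightarrow> - s + t \<in> K"
      using coarse_embedding_proper[OF u] by blast
    have "cmod (\<psi> n (x, y)) < e" if "(x, y) \<notin> Tube K" for x y
    proof -
      have "r < norm (u x - u y)" using that K(2)[of x y] by (simp add: not_le[symmetric]) blast
      then have "r\<^sup>2 \<le> (norm (u x - u y))\<^sup>2" using r0 by (intro power_mono) auto
      then have "(1 + \<bar>ln e\<bar>) \<le> (1 / real (Suc n)) * (norm (u x - u y))\<^sup>2"
        unfolding r2 by (simp add: field_simps)
      then have "- (1 / real (Suc n)) * (norm (u x - u y))\<^sup>2 < ln e" by linarith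
      then have "exp (- (1 / real (Suc n)) * (norm (u x - u y))\<^sup>2) < exp (ln e)"
        by (subst exp_less_cancel_iff)
      then show ?thesis using e by (simp add: \<psi>_def)
    qed
    then show "\<exists>T. is_tube T \<and> (\<forall>x y. (x, y) \<notin> T \<longrightarrow> cmod (\<psi> n (x, y)) < e)"
      using K(1) by (intro exI[of _ "Tube K"]) (auto simp only: is_tube_def)
  qed
  moreover have "uniform_limit T \<psi> (\<lambda>_. 1) sequentially" if T: "is_tube T" for T
  proof -
    obtain K where K: "compact K" "T \<subseteq> Tube K" using T unfolding is_tube_def by blast
    obtain R where R: "R > 0" "\<And>s t. - s + t \<in> K \<Longrightarrow> norm (u s - u t) \<le> R"
      using coarse_embedding_bound[OF u K(1)] by blast
    show ?thesis
      unfolding uniform_limit_iff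
    proof (intro allI impI)
      fix e :: real assume e: "0 < e"
      obtain N :: nat where N: "R\<^sup>2 / e < real N" using reals_Archimedean2 by blast
      have "dist (\<psi> n p) 1 < e" if n: "N \<le> n" and p: "p \<in> T" for n p
      proof -
        obtain x y where xy: "p = (x, y)" by fastforce
        define z where "z = (1 / real (Suc n)) * (norm (u x - u y))\<^sup>2"
        have z0: "0 \<le> z" by (simp add: z_def)
        have "norm (u x - u y) \<le> R" using p xy K(2) by (intro R(2)) auto
        then have "(norm (u x - u y))\<^sup>2 \<le> R\<^sup>2" by (intro power_mono) auto
        also have "\<dots> < e * real (Suc n)"
        proof -
          have "R\<^sup>2 < e * real N" using N e by (simp add: field_simps)
          also have "\<dots> \<le> e * real (Suc n)" using n e by (intro mult_left_mono) auto
          finally show ?thesis .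
        qed
        finally have "z < e" by (simp add: z_def field_simps)
        have "dist (\<psi> n p) 1 = cmod (of_real (exp (- z) - 1))"
          by (simp add: \<psi>_def xy z_def dist_norm)
        also have "\<dots> = \<bar>exp (- z) - 1\<bar>" by (rule norm_of_real)
        also have "\<dots> = 1 - exp (- z)" using z0 by simp
        also have "\<dots> \<le> z" using exp_ge_add_one_self[of "- z"] by simp
        finally show ?thesis using \<open>z < e\<close> by simp
      qed
      then show "\<forall>\<^sub>F n in sequentially. \<forall>p\<in>T. dist (\<psi> n p) 1 < e"
        unfolding eventually_sequentially by blast
    qed
  qed
  ultimately show ?thesis unfolding schur_approximation_def \<psi>_def by blast
qed

text \<open>Two copies of the index set carry the kernel whose off-diagonal block is \<open>Re \<phi>\<close>; its Gram vectors on the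
two copies are \<open>\<xi>\<close> and \<open>\<eta>\<close>.\<close>

theorem schur_contraction_factorisation:
  fixes \<phi> :: "'i \<times> 'i \<Rightarrow> complex"
  assumes "schur_multiplier \<phi>" "schur_norm \<phi> \<le> 1"
  shows "\<exists>\<xi> \<eta> :: 'i \<Rightarrow> ('i + 'i) ell2. (\<forall>x. norm (\<xi> x) = 1 \<and> norm (\<eta> x) = 1) \<and>
    (\<forall>x y. inner (\<xi> x) (\<eta> y) = Re (\<phi> (x, y)))"
proof -
  obtain P :: "'i + 'i \<Rightarrow> 'i + 'i \<Rightarrow> real" where P: "pos_def_kernel P" "\<And>x. P x x = 1"
      "\<And>x y. P (Inl x) (Inr y) = Re (\<phi> (x, y))"
    using contractive_schur_imp_pos_def_block[OF schur_contraction_real_part[OF assms]] by blast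
  obtain v :: "'i + 'i \<Rightarrow> ('i + 'i) ell2" where v: "\<And>x y. inner (v x) (v y) = P x y"
    using kolmogorov_decomposition[OF P(1) inj_on_id] by metis
  show ?thesis
    by (intro exI[of _ "\<lambda>x. v (Inl x)"] exI[of _ "\<lambda>x. v (Inr x)"])
      (simp add: norm_eq_sqrt_inner v P)
qed

text \<open>For unit vectors, \<open>(norm (\<xi> x - \<eta> y))\<^sup>2 = 2 - 2 * Re (\<phi> (x, y))\<close>. So \<open>\<xi>\<close> and \<open>\<eta>\<close> nearly agree on the diagonal,
and up to this error \<open>norm (\<eta> x - \<eta> y)\<close> is controlled by \<open>\<phi> (x, y)\<close> in both directions.\<close>

lemma schur_contraction_separating_map:
  fixes \<phi> :: "'a::topological_group_add \<times> 'a \<Rightarrow> complex"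
  assumes \<phi>: "schur_multiplier \<phi>" "schur_norm \<phi> \<le> 1"
    and near: "\<And>x y. - x + y \<in> K \<Longrightarrow> cmod (\<phi> (x, y) - 1) \<le> \<delta>\<^sup>2 / 8" "0 \<in> K"
    and far: "\<And>x y. - x + y \<notin> L \<Longrightarrow> cmod (\<phi> (x, y)) \<le> 1 / 2"
    and \<delta>: "0 \<le> \<delta>" "\<delta> \<le> 1"
  shows "\<exists>h :: 'a \<Rightarrow> ('a + 'a) ell2. (\<forall>x. norm (h x) = 1) \<and>
    (\<forall>x y. - x + y \<in> K \<longrightarrow> norm (h x - h y) \<le> \<delta>) \<and>
    (\<forall>x y. - x + y \<notin> L \<longrightarrow> 1 / 2 \<le> norm (h x - h y))"
proof -
  obtain \<xi> \<eta> :: "'a \<Rightarrow> ('a + 'a) ell2" where unit: "\<And>x. norm (\<xi> x) = 1" "\<And>x. norm (\<eta> x) = 1"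
    and inner: "\<And>x y. inner (\<xi> x) (\<eta> y) = Re (\<phi> (x, y))"
    using schur_contraction_factorisation[OF \<phi>] by metis
  have sq: "(norm (\<xi> x - \<eta> y))\<^sup>2 = 2 - 2 * Re (\<phi> (x, y))" for x y
    unfolding norm_diff_square using unit by (simp add: inner flip: power2_norm_eq_inner)
  have close: "norm (\<xi> x - \<eta> y) \<le> \<delta> / 2" if "- x + y \<in> K" for x y
  proof -
    have "1 - Re (\<phi> (x, y)) \<le> cmod (\<phi> (x, y) - 1)"
      using abs_Re_le_cmod[of "\<phi> (x, y) - 1"] by simp
    with near(1)[OF that] have "(norm (\<xi> x - \<eta> y))\<^sup>2 \<le> 2 * (\<delta>\<^sup>2 / 8)" unfolding sq by simp
    also have "\<dots> = (\<delta> / 2)\<^sup>2" by (simp add: power_divide)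
    finally show ?thesis by (rule power2_le_imp_le) (use \<delta> in simp)
  qed
  have diag: "norm (\<xi> x - \<eta> x) \<le> \<delta> / 2" for x
    using close[of x x] near(2) by simp
  have "norm (\<eta> x - \<eta> y) \<le> \<delta>" if "- x + y \<in> K" for x y
  proof -
    have "norm (\<eta> x - \<eta> y) \<le> norm (\<eta> x - \<xi> x) + norm (\<xi> x - \<eta> y)"
      using norm_triangle_ineq[of "\<eta> x - \<xi> x" "\<xi> x - \<eta> y"] by simp
    also have "\<dots> \<le> \<delta> / 2 + \<delta> / 2"
      using diag[of x] close[OF that] by (intro add_mono) (simp_all add: norm_minus_commute)
    finally show ?thesis by simp
  qed
  moreover have "1 / 2 \<le> norm (\<eta> x - \<eta> y)" if "- x + y \<notin> L" for x y
  proof -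
    have "Re (\<phi> (x, y)) \<le> 1 / 2"
      using far[OF that] complex_Re_le_cmod[of "\<phi> (x, y)"] by linarith
    then have "1\<^sup>2 \<le> (norm (\<xi> x - \<eta> y))\<^sup>2" unfolding sq by simp
    then have "1 \<le> norm (\<xi> x - \<eta> y)" by (rule power2_le_imp_le) simp
    also have "\<dots> \<le> norm (\<xi> x - \<eta> x) + norm (\<eta> x - \<eta> y)"
      using norm_triangle_ineq[of "\<xi> x - \<eta> x" "\<eta> x - \<eta> y"] by simp
    also have "\<dots> \<le> 1 / 2 + norm (\<eta> x - \<eta> y)" using diag[of x] \<delta>(2) by simp
    finally show ?thesis by simp
  qed
  ultimately show ?thesis using unit by blast
qed

text \<open>The direct sum of the maps \<open>h n\<close>, normalised to vanish at \<open>0\<close>, is realised through its kernel \<open>k\<close>. On a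
tube all but finitely many summands of the squared distance are dominated by a geometric series. If
\<open>(x, y)\<close> lies outside the tubes of \<open>L 0, \<dots>, L (N - 1)\<close>, the squared distance is at least \<open>N / 4\<close>.\<close>

lemma coarse_embedding_of_maps:
  fixes h :: "nat \<Rightarrow> 'a::topological_group_add \<Rightarrow> 'h::real_inner" and K L :: "nat \<Rightarrow> 'a set"
  assumes K: "\<And>m n. m \<le> n \<Longrightarrow> K m \<subseteq> K n" "\<And>D. compact D \<Longrightarrow> \<exists>n. D \<subseteq> K n"
    and L: "\<And>n. compact (L n)" and h: "\<And>n x. norm (h n x) \<le> 1"
    and near: "\<And>n x y. - x + y \<in> K n \<Longrightarrow> norm (h n x - h n y) \<le> (1 / 2) ^ n"
    and far: "\<And>n x y. - x + y \<notin> L n \<Longrightarrow> 1 / 2 \<le> norm (h n x - h n y)"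
  shows "embeds_coarsely TYPE('a)"
proof -
  define d where "d n x = h n x - h n 0" for n x
  define k where "k x y = (\<Sum>n. inner (d n x) (d n y))" for x y
  have le2: "norm (h n x - h n y) \<le> 2" for n x y
    using norm_triangle_ineq4[of "h n x" "h n y"] h[of n x] h[of n y] by linarith
  have summ: "summable (\<lambda>n. inner (d n x) (d n y))" for x y
  proof -
    obtain N where N: "x \<in> K N" using K(2)[of "{x}"] by auto
    have bd: "norm (inner (d n x) (d n y)) \<le> 2 * (1 / 2) ^ n" if "N \<le> n" for n
    proof -
      have "x \<in> K n" using N K(1)[OF that] by blast
      then have "norm (d n x) \<le> (1 / 2) ^ n"
        using near[of 0 x n] by (simp add: d_def norm_minus_commute)
      then have "norm (d n x) * norm (d n y) \<le> (1 / 2) ^ n * 2"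
        using le2 by (intro mult_mono) (auto simp: d_def)
      then show ?thesis using Cauchy_Schwarz_ineq2[of "d n x" "d n y"] by simp
    qed
    have "summable (\<lambda>n. 2 * (1 / 2) ^ n :: real)"
      by (intro summable_mult summable_geometric) simp
    then show ?thesis by (rule summable_comparison_test'[OF _ bd])
  qed
  have "pos_def_kernel k"
  proof (rule pos_def_kernel_lim)
    show "pos_def_kernel (\<lambda>x y. \<Sum>i<n. inner (d i x) (d i y))" for n
      by (intro pos_def_kernel_sum pos_def_kernel_gram)
    show "(\<lambda>n. \<Sum>i<n. inner (d i x) (d i y)) \<longlonglongrightarrow> k x y" for x y
      unfolding k_def by (rule summable_LIMSEQ[OF summ])
  qed
  then obtain v :: "'a \<Rightarrow> ('a \<times> nat) ell2"
    where v: "\<And>x y. (norm (v x - v y))\<^sup>2 = k x x + k y y - 2 * k x y"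
    using kernel_distance_realisation by blast
  have sums: "(\<lambda>n. (norm (h n x - h n y))\<^sup>2) sums (norm (v x - v y))\<^sup>2" for x y
  proof -
    have "(\<lambda>n. inner (d n x) (d n x) + inner (d n y) (d n y) - 2 * inner (d n x) (d n y))
        sums (norm (v x - v y))\<^sup>2"
      unfolding v k_def by (intro sums_add sums_diff sums_mult summable_sums summ)
    moreover have "inner (d n x) (d n x) + inner (d n y) (d n y) - 2 * inner (d n x) (d n y) =
        (norm (h n x - h n y))\<^sup>2" for n
      unfolding norm_diff_square[symmetric] by (simp add: d_def)
    ultimately show ?thesis by simp
  qed
  have "coarse_embedding v"
    unfolding coarse_embedding_def
  proof (intro conjI allI impI)
    fix C :: "'a set" assume "compact C"
    then obtain N where N: "C \<subseteq> K N" using K(2) by blast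
    define R where "R = real N * 4 + 2"
    have "norm (v s - v t) \<le> R" if "(s, t) \<in> Tube C" for s t
    proof -
      have st: "- s + t \<in> K N" using that N by auto
      have majorant: "(\<lambda>n. (if n \<in> {..<N} then 4 else 0) + (1 / 2) ^ n) sums ((\<Sum>n<N. 4) + 1 / (1 - 1 / 2) :: real)"
        by (intro sums_add sums_If_finite_set geometric_sums) auto
      have "(norm (h n s - h n t))\<^sup>2 \<le> (if n \<in> {..<N} then 4 else 0) + (1 / 2) ^ n" for n
      proof (cases "n < N")
        case True
        have "(norm (h n s - h n t))\<^sup>2 \<le> 2\<^sup>2" by (intro power_mono le2) simp
        with True show ?thesis by (simp add: add_increasing2)
      next
        case False
        then have "- s + t \<in> K n" using st K(1)[of N n] by auto
        from near[OF this] have "(norm (h n s - h n t))\<^sup>2 \<le> ((1 / 2) ^ n)\<^sup>2" by (intro power_mono) auto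
        also have "\<dots> \<le> (1 / 2) ^ n" by (simp add: power2_eq_square mult_left_le power_le_one)
        finally show ?thesis using False by simp
      qed
      from sums_le[OF this sums majorant]
      have "(norm (v s - v t))\<^sup>2 \<le> (\<Sum>n<N. 4) + 1 / (1 - 1 / 2)" .
      also have "\<dots> = R" by (simp add: R_def)
      also have "\<dots> \<le> R\<^sup>2" by (simp add: R_def power2_eq_square mult_le_cancel_left1)
      finally show ?thesis by (rule power2_le_imp_le) (simp add: R_def)
    qed
    then show "\<exists>R>0. \<forall>s t. (s, t) \<in> Tube C \<longrightarrow> norm (v s - v t) \<le> R"
      by (intro exI[of _ R]) (simp add: R_def)
  next
    fix R :: real assume R: "0 < R"
    obtain N :: nat where N: "R\<^sup>2 * 4 < real N" using reals_Archimedean2 by blast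
    have "(s, t) \<in> Tube (\<Union>n<N. L n)" if le: "norm (v s - v t) \<le> R" for s t
    proof (rule ccontr)
      assume "(s, t) \<notin> Tube (\<Union>n<N. L n)"
      then have "1 / 2 \<le> norm (h n s - h n t)" if "n < N" for n using that by (intro far) auto
      then have "(1 / 2)\<^sup>2 \<le> (norm (h n s - h n t))\<^sup>2" if "n < N" for n
        using that by (intro power_mono) auto
      then have "(\<Sum>n<N. (1 / 2)\<^sup>2) \<le> (\<Sum>n<N. (norm (h n s - h n t))\<^sup>2)"
        by (intro sum_mono) auto
      also have "\<dots> \<le> (norm (v s - v t))\<^sup>2"
        unfolding sums_unique[OF sums[of s t]]
        by (rule sum_le_suminf[OF sums_summable[OF sums]]) auto
      also have "\<dots> \<le> R\<^sup>2" using le by (intro power_mono) auto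
      finally show False using N by (simp add: power_divide)
    qed
    then show "\<exists>K. compact K \<and> (\<forall>s t. norm (v s - v t) \<le> R \<longrightarrow> (s, t) \<in> Tube K)"
      by (intro exI[of _ "\<Union>n<N. L n"] conjI compact_UN finite_lessThan L) auto
  qed
  then show ?thesis unfolding embeds_coarsely_def by blast
qed

text \<open>The \<open>n\<close>-th map comes from a multiplier \<open>\<phi> (m n)\<close> that is so close to \<open>1\<close> on the \<open>n\<close>-th member of a
compact exhaustion that the map moves by at most \<open>(1 / 2) ^ n\<close> there.\<close>

theorem schur_approximation_imp_embeds_coarsely:
  fixes \<phi> :: "nat \<Rightarrow> 'a::topological_group_add \<times> 'a \<Rightarrow> complex"
  assumes lc: "locally_compact_space (euclidean :: 'a topology)"
    and sc: "sigma_compact (UNIV :: 'a set)" and \<phi>: "schur_approximation \<phi>"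
  shows "embeds_coarsely TYPE('a)"
proof -
  obtain K :: "nat \<Rightarrow> 'a set" where K: "\<And>n. compact (K n)" "\<And>n. 0 \<in> K n"
    "\<And>m n. m \<le> n \<Longrightarrow> K m \<subseteq> K n" "\<And>D. compact D \<Longrightarrow> \<exists>n. D \<subseteq> K n"
    using compact_exhaustion[OF lc sc] by metis
  have "\<exists>m. \<forall>x y. - x + y \<in> K n \<longrightarrow> cmod (\<phi> m (x, y) - 1) \<le> ((1 / 2) ^ n)\<^sup>2 / 8" for n
  proof -
    have "is_tube (Tube (K n))" using K(1) by (auto simp only: is_tube_def)
    then have "uniform_limit (Tube (K n)) \<phi> (\<lambda>_. 1) sequentially"
      using \<phi> by (simp add: schur_approximation_def)
    then have "\<forall>\<^sub>F m in sequentially. \<forall>p\<in>Tube (K n). dist (\<phi> m p) 1 < ((1 / 2) ^ n)\<^sup>2 / 8"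
      by (rule uniform_limitD) simp
    then obtain m where m: "\<And>p. p \<in> Tube (K n) \<Longrightarrow> dist (\<phi> m p) 1 < ((1 / 2) ^ n)\<^sup>2 / 8"
      unfolding eventually_sequentially by blast
    show ?thesis
    proof (intro exI[of _ m] allI impI)
      fix x y assume "- x + y \<in> K n"
      then show "cmod (\<phi> m (x, y) - 1) \<le> ((1 / 2) ^ n)\<^sup>2 / 8"
        using m[of "(x, y)"] by (simp add: dist_norm)
    qed
  qed
  then obtain m where m: "\<And>n x y. - x + y \<in> K n \<Longrightarrow> cmod (\<phi> (m n) (x, y) - 1) \<le> ((1 / 2) ^ n)\<^sup>2 / 8"
    by metis
  have "\<exists>L. compact L \<and> (\<forall>x y. - x + y \<notin> L \<longrightarrow> cmod (\<phi> (m n) (x, y)) \<le> 1 / 2)" for n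
  proof -
    have "tends_to_zero_off_tubes (\<phi> (m n))"
      using \<phi> by (simp only: schur_approximation_def)
    then have "0 < (1 / 2 :: real) \<longrightarrow>
        (\<exists>T. is_tube T \<and> (\<forall>x y. (x, y) \<notin> T \<longrightarrow> cmod (\<phi> (m n) (x, y)) < 1 / 2))"
      unfolding tends_to_zero_off_tubes_def by (rule spec)
    then have "\<exists>T. is_tube T \<and> (\<forall>x y. (x, y) \<notin> T \<longrightarrow> cmod (\<phi> (m n) (x, y)) < 1 / 2)"
      by (rule mp) simp
    then obtain L where "compact L" "\<And>x y. (x, y) \<notin> Tube L \<Longrightarrow> cmod (\<phi> (m n) (x, y)) < 1 / 2"
      unfolding is_tube_def by blast
    then show ?thesis by (intro exI[of _ L]) (auto intro: less_imp_le)
  qed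
  then obtain L where L: "\<And>n. compact (L n)"
      "\<And>n x y. - x + y \<notin> L n \<Longrightarrow> cmod (\<phi> (m n) (x, y)) \<le> 1 / 2"
    by metis
  have "\<exists>h :: 'a \<Rightarrow> ('a + 'a) ell2. (\<forall>x. norm (h x) = 1) \<and>
    (\<forall>x y. - x + y \<in> K n \<longrightarrow> norm (h x - h y) \<le> (1 / 2) ^ n) \<and>
    (\<forall>x y. - x + y \<notin> L n \<longrightarrow> 1 / 2 \<le> norm (h x - h y))" for n
  proof (rule schur_contraction_separating_map[where \<phi> = "\<phi> (m n)"])
    show "schur_multiplier (\<phi> (m n))" "schur_norm (\<phi> (m n)) \<le> 1"
      using \<phi> by (simp_all add: schur_approximation_def)
  qed (assumption | rule m L(2) K(2) | simp add: power_le_one)+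
  then obtain h :: "nat \<Rightarrow> 'a \<Rightarrow> ('a + 'a) ell2" where
    h: "\<And>n x. norm (h n x) = 1" "\<And>n x y. - x + y \<in> K n \<Longrightarrow> norm (h n x - h n y) \<le> (1 / 2) ^ n"
      "\<And>n x y. - x + y \<notin> L n \<Longrightarrow> 1 / 2 \<le> norm (h n x - h n y)"
    by metis
  show ?thesis
    by (rule coarse_embedding_of_maps[OF K(3,4) L(1) _ h(2,3)]) (simp_all add: h(1))
qed

theorem theorem1:
  assumes "locally_compact_space (euclidean :: 'a::{topological_group_add, t2_space} topology)"
    and "sigma_compact (UNIV :: 'a set)"
  shows
    "(embeds_coarsely TYPE('a) \<longleftrightarrow> (\<exists>\<phi> :: nat \<Rightarrow> 'a \<times> 'a \<Rightarrow> complex. schur_approximation \<phi>)) \<and>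
     ((\<exists>u :: 'a \<Rightarrow> 'h::{real_inner, complete_space}. coarse_embedding u) \<longrightarrow>
        embeds_coarsely TYPE('a)) \<and>
     (embeds_coarsely TYPE('a) \<or> (\<exists>\<phi> :: nat \<Rightarrow> 'a \<times> 'a \<Rightarrow> complex. schur_approximation \<phi>) \<longrightarrow>
        (\<exists>u :: 'a \<Rightarrow> ('a \<times> nat) ell2. coarse_embedding u \<and> continuous_on UNIV u) \<and>
        (\<exists>\<phi> :: nat \<Rightarrow> 'a \<times> 'a \<Rightarrow> complex. schur_approximation \<phi> \<and> (\<forall>n. continuous_on UNIV (\<phi> n))))"
proof -
  have embeds: "embeds_coarsely TYPE('a)" if "schur_approximation \<phi>" for \<phi> :: "nat \<Rightarrow> 'a \<times> 'a \<Rightarrow> complex"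
    by (rule schur_approximation_imp_embeds_coarsely[OF assms that])
  have cont: "(\<exists>u :: 'a \<Rightarrow> ('a \<times> nat) ell2. coarse_embedding u \<and> continuous_on UNIV u) \<and>
      (\<exists>\<phi> :: nat \<Rightarrow> 'a \<times> 'a \<Rightarrow> complex. schur_approximation \<phi> \<and> (\<forall>n. continuous_on UNIV (\<phi> n)))"
    if coarse: "embeds_coarsely TYPE('a)"
  proof -
    obtain u :: "'a \<Rightarrow> ('a \<times> nat) ell2" where u: "coarse_embedding u" "continuous_on UNIV u"
      using coarse continuous_coarse_embedding[OF assms] unfolding embeds_coarsely_def by blast
    have u_comp: "continuous_on UNIV (\<lambda>p. u (f p))" if "continuous_on UNIV f" for f :: "'a \<times> 'a \<Rightarrow> 'a"
      by (rule continuous_on_compose2[OF u(2) that]) simp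
    have "continuous_on UNIV (\<lambda>(x, y). complex_of_real (exp (- (1 / real (Suc n)) * (norm (u x - u y))\<^sup>2)))" for n
      unfolding case_prod_beta by (intro continuous_intros u_comp)
    then show ?thesis using u schur_approximation_gaussian[OF u(1)] by blast
  qed
  show ?thesis
    using embeds cont coarse_embedding_imp_embeds_coarsely[where ?'h = 'h and ?'a = 'a] by blast
qed

end
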